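(* Let $(M,L)$ be a Finsler spacetime of dimension $4$, $N$ a lightlike gradient vector field, and $(x^0,x^1,x^2,x^3)$ lightlike coordinates for $N$ on an open set whose coordinate image contains the origin. For a constant $\Omega>0$ let $\varphi=\varphi_\Omega$ be the diffeomorphism $$(x^0,x^1,x^2,x^3)\mapsto(x^0,\Omega^{-2}x^1,\Omega^{-1}x^2,\Omega^{-1}x^3)=:(\tilde x^0,\tilde x^1,\tilde x^2,\tilde x^3),$$ and let $h_\Omega$ be the metric whose component matrix in the coordinates $(\tilde x^0,\dots,\tilde x^3)$ is $$\begin{pmatrix}0&1&0&0\\ 1&\Omega^2g_{11}(N)&\Omega g_{12}(N)&\Omega g_{13}(N)\\ 0&\Omega g_{21}(N)&h_{22}&h_{23}\\ 0&\Omega g_{31}(N)&h_{32}&h_{33}\end{pmatrix},$$ where the functions $g_{ij}(N)$ and $h_{ij}$ are evaluated at $(x^0,x^1,x^2,x^3)=(\tilde x^0,\Omega^2\tilde x^1,\Omega\tilde x^2,\Omega\tilde x^3)$. Then: (i) $(\varphi^{-1})^*g_N=\Omega^2h_\Omega$. (ii) As $\Omega\to0$, the components of $h_\Omega=\Omega^{-2}(\varphi^{-1})^*g_N$ converge, at each $(\tilde x^0,\dots,\tilde x^3)$ for which $(\tilde x^0,0,0,0)$ lies in the image of the original chart, to those of the metric $$\begin{pmatrix}0&1&0&0\\ 1&0&0&0\\ 0&0&h_{22}(\tilde x^0,0,0,0)&h_{23}(\tilde x^0,0,0,0)\\ 0&0&h_{32}(\tilde x^0,0,0,0)&h_{33}(\tilde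 x^0,0,0,0)\end{pmatrix}.$$ (iii) For $\tilde x^0$ sufficiently small, writing $h_{ij}=h_{ij}(\tilde x^0,0,0,0)$, there is a smooth matrix function $M=(M^i_j(\tilde x^0))_{2\le i,j\le3}$ with $h_{ij}M^i_kM^j_l=-\delta_{kl}$ and $h_{ij}\dot M^i_kM^j_l=h_{ij}M^i_k\dot M^j_l$ (dot denoting $d/d\tilde x^0$, with summation over repeated indices in $\{2,3\}$), and the coordinate transformation $$\tilde x^0=u,\qquad \tilde x^1=v-\tfrac12h_{ij}\dot M^i_kM^j_lx^kx^l,\qquad \tilde x^i=M^i_jx^j\quad(i=2,3)$$ to new coordinates $(v,u,x^2,x^3)$ brings the limit metric of (ii) to the Brinkmann form $$\begin{pmatrix}0&1&0&0\\ 1&H&0&0\\ 0&0&-1&0\\ 0&0&0&-1\end{pmatrix},\qquad H=-\frac{d}{du}\big(h_{ij}\dot M^i_k\big)M^j_l\,x^kx^l .$$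
   Context: Finsler spacetime: $M$ is a connected smooth manifold, $\pi\colon TM\to M$ its tangent bundle. $A\subset TM\setminus\mathbf 0$ is a connected open subset which is conic ($\lambda v\in A$ for all $v\in A$, $\lambda>0$), has smooth boundary, and is such that $A_p=A\cap T_pM\neq\emptyset$ for all $p\in M$; $\bar A$ is its closure in $TM\setminus\mathbf 0$ and $\bar A_p=\bar A\cap T_pM$. The pair $(M,L)$ is a Finsler spacetime if $L\colon\bar A\to[0,\infty)$ is smooth, positively homogeneous of degree $2$ on each $\bar A_p$, its fundamental tensor $$g_v(u,w)=\frac12\left.\frac{\partial^2}{\partial s\,\partial t}L(v+tu+sw)\right|_{t=s=0},\qquad v\in\bar A,\ u,w\in T_{\pi(v)}M,$$ has signature $(+,-,\dots,-)$, and the boundary of $\bar A$ in $TM\setminus\mathbf 0$ coincides with the lightcone $\mathcal C=L^{-1}(0)$. Gradient: a smooth function $f$ on an open set admits a gradient $\nabla f$ if there is a vector field $\nabla f$ on that set with values in $\bar A$ such that $g_{\nabla f}(\nabla f,X)=df(X)$ for all vector fields $X$. A lightlike gradient vector field is $N=\nabla f$ with $L(N)=0$. $g_N$ is the metric obtained by evaluating $g_v$ at $v=N$, and $g_{ij}(N)=g_N(\partial_i,\partial_j)$. Lightlike coordinates for $N$: coordinates $(x^0,\dots,x^3)$ with $N=\partial/\partial x^0$ in which $$(g_{ij}(N))=\begin{pmatrix}0&1&0&0\\ 1&g_{11}(N)&g_{12}(N)&g_{13}(N)\\ 0&g_{21}(N)&h_{22}&h_{23}\\ 0&g_{31}(N)&h_{32}&h_{33}\end{pmatrix},$$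 with $(h_{ij})$ a negative-definite $2\times2$ matrix. (In (iii), the letter $M$ denotes the matrix function, not the manifold, and the $x^k$ with $k=2,3$ are the new Brinkmann coordinates.) *)

theory Defs
  imports "HOL-Analysis.Analysis"
begin

section \<open>Smooth maps between open subsets of normed spaces\<close>

text \<open>\<open>Ck_on k S f\<close> is the usual notion of a \<open>C\<^sup>k\<close> map when \<open>S\<close> is open and the
  domain is finite-dimensional; it is only used in that situation.\<close>

primrec Ck_on ::
  "nat \<Rightarrow> 'e::euclidean_space set \<Rightarrow> ('e \<Rightarrow> 'f::real_normed_vector) \<Rightarrow> bool" where
  "Ck_on 0 S f \<longleftrightarrow> continuous_on S f"
| "Ck_on (Suc k) S f \<longleftrightarrow>
     (\<forall>x\<in>S. f differentiable (at x)) \<and> (\<forall>v. Ck_on k S (\<lambda>x. frechet_derivative f (at x) v))"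

definition smooth_on :: "'e::euclidean_space set \<Rightarrow> ('e \<Rightarrow> 'f::real_normed_vector) \<Rightarrow> bool" where
  "smooth_on S f \<longleftrightarrow> (\<forall>k. Ck_on k S f)"

definition diffeomorphism_between ::
  "'e::euclidean_space set \<Rightarrow> 'f::euclidean_space set \<Rightarrow> ('e \<Rightarrow> 'f) \<Rightarrow> bool" where
  "diffeomorphism_between S T f \<longleftrightarrow>
     open S \<and> open T \<and> bij_betw f S T \<and> smooth_on S f \<and> smooth_on T (inv_into S f)"


section \<open>Smooth manifolds\<close>

text \<open>A chart is a pair of its domain and its coordinate map; the values of the coordinate map
  outside the domain are irrelevant.  The dimension is that of the model space \<open>'e\<close>.\<close>

type_synonym ('a, 'e) chart = "'a set \<times> ('a \<Rightarrow> 'e)"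

definition chart_inv :: "('a, 'e) chart \<Rightarrow> 'e \<Rightarrow> 'a" where
  "chart_inv c = inv_into (fst c) (snd c)"

definition is_chart :: "'a topology \<Rightarrow> ('a, 'e::euclidean_space) chart \<Rightarrow> bool" where
  "is_chart X c \<longleftrightarrow> openin X (fst c) \<and> open (snd c ` fst c) \<and>
     homeomorphic_map (subtopology X (fst c)) (top_of_set (snd c ` fst c)) (snd c)"

definition compatible_charts ::
  "('a, 'e::euclidean_space) chart \<Rightarrow> ('a, 'e) chart \<Rightarrow> bool" where
  "compatible_charts c d \<longleftrightarrow>
     smooth_on (snd c ` (fst c \<inter> fst d)) (snd d \<circ> chart_inv c) \<and>
     smooth_on (snd d ` (fst c \<inter> fst d)) (snd c \<circ> chart_inv d)"

definition smooth_manifold ::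
  "'a topology \<Rightarrow> ('a, 'e::euclidean_space) chart set \<Rightarrow> bool" where
  "smooth_manifold X \<A> \<longleftrightarrow>
     Hausdorff_space X \<and> second_countable X \<and>
     (\<forall>c\<in>\<A>. is_chart X c) \<and> (\<Union>c\<in>\<A>. fst c) = topspace X \<and>
     (\<forall>c\<in>\<A>. \<forall>d\<in>\<A>. compatible_charts c d) \<and>
     (\<forall>c. is_chart X c \<and> (\<forall>d\<in>\<A>. compatible_charts c d) \<longrightarrow> c \<in> \<A>)"

text \<open>Smoothness on an arbitrary subset \<open>S\<close> of a manifold: existence of smooth extensions to open
  neighbourhoods of the points of \<open>S\<close>.  For open \<open>S\<close> this is ordinary smoothness.\<close>

definition smooth_on_open ::
  "('a, 'e::euclidean_space) chart set \<Rightarrow> 'a set \<Rightarrow> ('a \<Rightarrow> real) \<Rightarrow> bool" where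
  "smooth_on_open \<A> W F \<longleftrightarrow> (\<forall>c\<in>\<A>. smooth_on (snd c ` (W \<inter> fst c)) (F \<circ> chart_inv c))"

definition local_extension ::
  "'a topology \<Rightarrow> ('a, 'e::euclidean_space) chart set \<Rightarrow> 'a set \<Rightarrow> ('a \<Rightarrow> real)
     \<Rightarrow> 'a \<Rightarrow> 'a set \<Rightarrow> ('a \<Rightarrow> real) \<Rightarrow> bool" where
  "local_extension X \<A> S f p W F \<longleftrightarrow>
     openin X W \<and> p \<in> W \<and> smooth_on_open \<A> W F \<and> (\<forall>q\<in>W \<inter> S. F q = f q)"

definition smooth_fun ::
  "'a topology \<Rightarrow> ('a, 'e::euclidean_space) chart set \<Rightarrow> 'a set \<Rightarrow> ('a \<Rightarrow> real) \<Rightarrow> bool" where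
  "smooth_fun X \<A> S f \<longleftrightarrow> (\<forall>p\<in>S. \<exists>W F. local_extension X \<A> S f p W F)"


section \<open>The tangent bundle\<close>

text \<open>A tangent vector at \<open>p\<close> is the family of its component vectors in all charts around \<open>p\<close>,
  subject to the usual transformation law (and \<open>0\<close> at all other arguments, for extensionality).
  The vector space operations are pointwise.\<close>

type_synonym ('a, 'e) tvec = "('a, 'e) chart \<Rightarrow> 'e"

definition tangent_space ::
  "('a, 'e::euclidean_space) chart set \<Rightarrow> 'a \<Rightarrow> ('a, 'e) tvec set" where
  "tangent_space \<A> p = {v.
     (\<forall>c\<in>\<A>. \<forall>d\<in>\<A>. p \<in> fst c \<and> p \<in> fst d \<longrightarrow>
        v d = frechet_derivative (snd d \<circ> chart_inv c) (at (snd c p)) (v c)) \<and>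
     (\<forall>c. \<not> (c \<in> \<A> \<and> p \<in> fst c) \<longrightarrow> v c = 0)}"

text \<open>The vector \<open>y\<^sup>i \<partial>\<^sub>i\<close> at \<open>p\<close>, for the coordinates given by \<open>c\<close>.\<close>

definition coord_vec ::
  "('a, 'e::euclidean_space) chart set \<Rightarrow> ('a, 'e) chart \<Rightarrow> 'a \<Rightarrow> 'e \<Rightarrow> ('a, 'e) tvec" where
  "coord_vec \<A> c p y = (\<lambda>d. if d \<in> \<A> \<and> p \<in> fst d
     then frechet_derivative (snd d \<circ> chart_inv c) (at (snd c p)) y else 0)"

definition tangent_bundle ::
  "'a topology \<Rightarrow> ('a, 'e::euclidean_space) chart set \<Rightarrow> ('a \<times> ('a, 'e) tvec) set" where
  "tangent_bundle X \<A> = (SIGMA p:topspace X. tangent_space \<A> p)"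

definition bundle_atlas ::
  "'a topology \<Rightarrow> ('a, 'e::euclidean_space) chart set
     \<Rightarrow> ('a \<times> ('a, 'e) tvec, 'e \<times> 'e) chart set" where
  "bundle_atlas X \<A> =
     (\<lambda>c. ({w \<in> tangent_bundle X \<A>. fst w \<in> fst c}, \<lambda>w. (snd c (fst w), snd w c))) ` \<A>"

definition bundle_topology ::
  "'a topology \<Rightarrow> ('a, 'e::euclidean_space) chart set \<Rightarrow> ('a \<times> ('a, 'e) tvec) topology" where
  "bundle_topology X \<A> =
     topology_generated_by {{w \<in> fst b. snd b w \<in> Q} | b Q. b \<in> bundle_atlas X \<A> \<and> open Q}"

definition zero_section ::
  "'a topology \<Rightarrow> ('a \<times> ('a, 'e::euclidean_space) tvec) set" where
  "zero_section X = topspace X \<times> {\<lambda>_. 0}"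

text \<open>The topological space \<open>TM\<close> without the zero section.\<close>

definition slit_topology ::
  "'a topology \<Rightarrow> ('a, 'e::euclidean_space) chart set \<Rightarrow> ('a \<times> ('a, 'e) tvec) topology" where
  "slit_topology X \<A> =
     subtopology (bundle_topology X \<A>) (tangent_bundle X \<A> - zero_section X)"

definition vector_field_on ::
  "('a, 'e::euclidean_space) chart set \<Rightarrow> 'a set \<Rightarrow> ('a \<Rightarrow> ('a, 'e) tvec) \<Rightarrow> bool" where
  "vector_field_on \<A> D V \<longleftrightarrow> (\<forall>p\<in>D. V p \<in> tangent_space \<A> p) \<and>
     (\<forall>c\<in>\<A>. smooth_on (snd c ` (D \<inter> fst c)) (\<lambda>x. V (chart_inv c x) c))"

text \<open>The value \<open>df\<^sub>p(v)\<close>; it does not depend on the chart chosen.\<close>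

definition differential ::
  "('a, 'e::euclidean_space) chart set \<Rightarrow> ('a \<Rightarrow> real) \<Rightarrow> 'a \<Rightarrow> ('a, 'e) tvec \<Rightarrow> real" where
  "differential \<A> f p v = (let c = (SOME c. c \<in> \<A> \<and> p \<in> fst c)
     in frechet_derivative (f \<circ> chart_inv c) (at (snd c p)) (v c))"

text \<open>Open subsets with smooth boundary: near each boundary point, \<open>A\<close> is the negative side of a
  smooth function without critical points.\<close>

definition smooth_boundary ::
  "'a topology \<Rightarrow> ('a, 'e::euclidean_space) chart set \<Rightarrow> 'a set \<Rightarrow> bool" where
  "smooth_boundary X \<A> A \<longleftrightarrow> (\<forall>p \<in> X frontier_of A. \<exists>W \<rho>.
     openin X W \<and> p \<in> W \<and> smooth_on_open \<A> W \<rho> \<and>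
     (\<forall>q\<in>W. \<forall>c\<in>\<A>. q \<in> fst c \<longrightarrow>
        frechet_derivative (\<rho> \<circ> chart_inv c) (at (snd c q)) \<noteq> (\<lambda>_. 0)) \<and>
     A \<inter> W = {q \<in> W. \<rho> q < 0})"


section \<open>Finsler spacetimes\<close>

text \<open>Symmetric bilinear forms of signature \<open>(+,-,\<dots>,-)\<close>.\<close>

definition lorentzian_form :: "('e::euclidean_space \<Rightarrow> 'e \<Rightarrow> real) \<Rightarrow> bool" where
  "lorentzian_form B \<longleftrightarrow> bilinear B \<and> (\<forall>x y. B x y = B y x) \<and>
     (\<exists>E e. independent E \<and> span E = UNIV \<and> e \<in> E \<and> B e e = 1 \<and>
        (\<forall>x\<in>E - {e}. B x x = -1) \<and> (\<forall>x\<in>E. \<forall>y\<in>E. x \<noteq> y \<longrightarrow> B x y = 0))"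

definition conic_closure ::
  "'a topology \<Rightarrow> ('a, 'e::euclidean_space) chart set \<Rightarrow> ('a \<times> ('a, 'e) tvec) set
     \<Rightarrow> ('a \<times> ('a, 'e) tvec) set" where
  "conic_closure X \<A> A = slit_topology X \<A> closure_of A"

text \<open>The fundamental tensor \<open>g\<^sub>v(u,w)\<close> at \<open>v \<in> T\<^sub>pM\<close>.  At boundary points of the domain of \<open>L\<close> the
  second derivative is that of a smooth local extension of \<open>L\<close>; since the domain is the closure of
  an open set, it does not depend on the extension.\<close>

definition fundamental_tensor ::
  "'a topology \<Rightarrow> ('a, 'e::euclidean_space) chart set \<Rightarrow> ('a \<times> ('a, 'e) tvec) set
     \<Rightarrow> ('a \<times> ('a, 'e) tvec \<Rightarrow> real) \<Rightarrow> 'a \<Rightarrow> ('a, 'e) tvec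
     \<Rightarrow> ('a, 'e) tvec \<Rightarrow> ('a, 'e) tvec \<Rightarrow> real" where
  "fundamental_tensor X \<A> A L p v u w = (THE r. \<exists>W F.
     local_extension (bundle_topology X \<A>) (bundle_atlas X \<A>) (conic_closure X \<A> A) L (p, v) W F \<and>
     r = 1/2 * deriv (\<lambda>s. deriv (\<lambda>t. F (p, \<lambda>c. v c + t *\<^sub>R u c + s *\<^sub>R w c)) 0) 0)"

definition finsler_spacetime ::
  "'a topology \<Rightarrow> ('a, 'e::euclidean_space) chart set \<Rightarrow> ('a \<times> ('a, 'e) tvec) set
     \<Rightarrow> ('a \<times> ('a, 'e) tvec \<Rightarrow> real) \<Rightarrow> bool" where
  "finsler_spacetime X \<A> A L \<longleftrightarrow>
     smooth_manifold X \<A> \<and> connected_space X \<and>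
     openin (slit_topology X \<A>) A \<and> connectedin (slit_topology X \<A>) A \<and>
     (\<forall>p v \<mu>. (p, v) \<in> A \<and> \<mu> > 0 \<longrightarrow> (p, \<lambda>c. \<mu> *\<^sub>R v c) \<in> A) \<and>
     smooth_boundary (slit_topology X \<A>) (bundle_atlas X \<A>) A \<and>
     (\<forall>p\<in>topspace X. \<exists>v. (p, v) \<in> A) \<and>
     (\<forall>w\<in>conic_closure X \<A> A. L w \<ge> 0) \<and>
     smooth_fun (bundle_topology X \<A>) (bundle_atlas X \<A>) (conic_closure X \<A> A) L \<and>
     (\<forall>p v \<mu>. (p, v) \<in> conic_closure X \<A> A \<and> \<mu> > 0 \<longrightarrow>
        L (p, \<lambda>c. \<mu> *\<^sub>R v c) = \<mu>\<^sup>2 * L (p, v)) \<and>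
     (\<forall>p v. (p, v) \<in> conic_closure X \<A> A \<longrightarrow> (\<forall>c\<in>\<A>. p \<in> fst c \<longrightarrow>
        lorentzian_form (\<lambda>a b. fundamental_tensor X \<A> A L p v
          (coord_vec \<A> c p a) (coord_vec \<A> c p b)))) \<and>
     slit_topology X \<A> frontier_of (conic_closure X \<A> A) = {w \<in> conic_closure X \<A> A. L w = 0}"

definition is_gradient ::
  "'a topology \<Rightarrow> ('a, 'e::euclidean_space) chart set \<Rightarrow> ('a \<times> ('a, 'e) tvec) set
     \<Rightarrow> ('a \<times> ('a, 'e) tvec \<Rightarrow> real) \<Rightarrow> 'a set \<Rightarrow> ('a \<Rightarrow> real)
     \<Rightarrow> ('a \<Rightarrow> ('a, 'e) tvec) \<Rightarrow> bool" where
  "is_gradient X \<A> A L D f N \<longleftrightarrow>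
     openin X D \<and> smooth_fun X \<A> D f \<and> vector_field_on \<A> D N \<and>
     (\<forall>p\<in>D. (p, N p) \<in> conic_closure X \<A> A) \<and>
     (\<forall>V. vector_field_on \<A> D V \<longrightarrow>
        (\<forall>p\<in>D. fundamental_tensor X \<A> A L p (N p) (N p) (V p) = differential \<A> f p (V p)))"

definition lightlike_gradient_field ::
  "'a topology \<Rightarrow> ('a, 'e::euclidean_space) chart set \<Rightarrow> ('a \<times> ('a, 'e) tvec) set
     \<Rightarrow> ('a \<times> ('a, 'e) tvec \<Rightarrow> real) \<Rightarrow> 'a set \<Rightarrow> ('a \<Rightarrow> ('a, 'e) tvec) \<Rightarrow> bool" where
  "lightlike_gradient_field X \<A> A L D N \<longleftrightarrow>
     (\<exists>f. is_gradient X \<A> A L D f N) \<and> (\<forall>p\<in>D. L (p, N p) = 0)"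


section \<open>Metrics in coordinates and Penrose limits in dimension 4\<close>

text \<open>Coordinates on \<open>\<real>\<^sup>4\<close> are numbered by \<open>0, 1, 2, 3\<close> of the index type \<open>4\<close> (in which \<open>4 = 0\<close>);
  the library function \<^const>\<open>vector\<close> would put its last entry at index \<open>0\<close>.\<close>

definition vec4 :: "'b \<Rightarrow> 'b \<Rightarrow> 'b \<Rightarrow> 'b \<Rightarrow> 'b ^ 4" where
  "vec4 a0 a1 a2 a3 =
     (\<chi> i. if i = 0 then a0 else if i = 1 then a1 else if i = 2 then a2 else a3)"

text \<open>The coordinate expression of \<open>g\<^sub>N\<close>, i.e. its pullback under the inverse of the chart \<open>c\<close>.\<close>

definition metric_at_field ::
  "'a topology \<Rightarrow> ('a, 'e::euclidean_space) chart set \<Rightarrow> ('a \<times> ('a, 'e) tvec) set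
     \<Rightarrow> ('a \<times> ('a, 'e) tvec \<Rightarrow> real) \<Rightarrow> ('a \<Rightarrow> ('a, 'e) tvec) \<Rightarrow> ('a, 'e) chart
     \<Rightarrow> 'e \<Rightarrow> 'e \<Rightarrow> 'e \<Rightarrow> real" where
  "metric_at_field X \<A> A L N c x a b = (let p = chart_inv c x in
     fundamental_tensor X \<A> A L p (N p) (coord_vec \<A> c p a) (coord_vec \<A> c p b))"

definition metric_components :: "(real ^ 4 \<Rightarrow> real ^ 4 \<Rightarrow> real ^ 4 \<Rightarrow> real) \<Rightarrow> real ^ 4 \<Rightarrow> real ^ 4 ^ 4" where
  "metric_components g x = (\<chi> i j. g x (axis i 1) (axis j 1))"

definition form_of :: "(real ^ 4 \<Rightarrow> real ^ 4 ^ 4) \<Rightarrow> real ^ 4 \<Rightarrow> real ^ 4 \<Rightarrow> real ^ 4 \<Rightarrow> real" where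
  "form_of G x a b = a \<bullet> (G x *v b)"

definition lorentzian_metric_on :: "(real ^ 4) set \<Rightarrow> (real ^ 4 \<Rightarrow> real ^ 4 ^ 4) \<Rightarrow> bool" where
  "lorentzian_metric_on S G \<longleftrightarrow>
     open S \<and> smooth_on S G \<and> (\<forall>x\<in>S. lorentzian_form (form_of G x))"

definition pullback ::
  "('e::euclidean_space \<Rightarrow> 'f::euclidean_space) \<Rightarrow> ('f \<Rightarrow> 'f \<Rightarrow> 'f \<Rightarrow> real)
     \<Rightarrow> 'e \<Rightarrow> 'e \<Rightarrow> 'e \<Rightarrow> real" where
  "pullback \<psi> g y a b =
     g (\<psi> y) (frechet_derivative \<psi> (at y) a) (frechet_derivative \<psi> (at y) b)"

definition lightlike_coordinates ::
  "'a topology \<Rightarrow> ('a, real ^ 4) chart set \<Rightarrow> ('a \<times> ('a, real ^ 4) tvec) set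
     \<Rightarrow> ('a \<times> ('a, real ^ 4) tvec \<Rightarrow> real) \<Rightarrow> ('a \<Rightarrow> ('a, real ^ 4) tvec)
     \<Rightarrow> ('a, real ^ 4) chart \<Rightarrow> bool" where
  "lightlike_coordinates X \<A> A L N c \<longleftrightarrow>
     c \<in> \<A> \<and> (\<forall>p\<in>fst c. N p = coord_vec \<A> c p (axis 0 1)) \<and>
     (\<forall>x\<in>snd c ` fst c. let G = metric_components (metric_at_field X \<A> A L N c) x in
        G = vec4 (vec4 0          1          0          0)
                 (vec4 1 (G $ 1 $ 1) (G $ 1 $ 2) (G $ 1 $ 3))
                 (vec4 0 (G $ 2 $ 1) (G $ 2 $ 2) (G $ 2 $ 3))
                 (vec4 0 (G $ 3 $ 1) (G $ 3 $ 2) (G $ 3 $ 3)) \<and>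
        (\<forall>\<xi>. \<xi> 2 \<noteq> 0 \<or> \<xi> 3 \<noteq> 0 \<longrightarrow> (\<Sum>i\<in>{2,3}. \<Sum>j\<in>{2,3}. G $ i $ j * \<xi> i * \<xi> j) < 0))"

definition scaling :: "real \<Rightarrow> real ^ 4 \<Rightarrow> real ^ 4" where
  "scaling \<Omega> x = vec4 (x $ 0) (x $ 1 / \<Omega>\<^sup>2) (x $ 2 / \<Omega>) (x $ 3 / \<Omega>)"

definition rescaled_metric :: "(real ^ 4 \<Rightarrow> real ^ 4 ^ 4) \<Rightarrow> real \<Rightarrow> real ^ 4 \<Rightarrow> real ^ 4 ^ 4" where
  "rescaled_metric G \<Omega> y = (let g = G (vec4 (y $ 0) (\<Omega>\<^sup>2 * y $ 1) (\<Omega> * y $ 2) (\<Omega> * y $ 3)) in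
     vec4 (vec4 0            1                0              0)
          (vec4 1 (\<Omega>\<^sup>2 * g $ 1 $ 1) (\<Omega> * g $ 1 $ 2) (\<Omega> * g $ 1 $ 3))
          (vec4 0 (\<Omega> * g $ 2 $ 1)    (g $ 2 $ 2)      (g $ 2 $ 3))
          (vec4 0 (\<Omega> * g $ 3 $ 1)    (g $ 3 $ 2)      (g $ 3 $ 3)))"

definition limit_metric :: "(real ^ 4 \<Rightarrow> real ^ 4 ^ 4) \<Rightarrow> real ^ 4 \<Rightarrow> real ^ 4 ^ 4" where
  "limit_metric G y = (let g = G (vec4 (y $ 0) 0 0 0) in
     vec4 (vec4 0 1      0           0)
          (vec4 1 0      0           0)
          (vec4 0 0 (g $ 2 $ 2) (g $ 2 $ 3))
          (vec4 0 0 (g $ 3 $ 2) (g $ 3 $ 3)))"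

text \<open>In the following, \<open>h i j\<close> and \<open>M i k\<close> (for \<open>i, j, k \<in> {2, 3}\<close>) are functions of \<open>u\<close>, the
  latter standing for \<open>M\<^sup>i\<^sub>k\<close>, and \<open>z = (v, u, x\<^sup>2, x\<^sup>3)\<close>.\<close>

definition brinkmann_map ::
  "(4 \<Rightarrow> 4 \<Rightarrow> real \<Rightarrow> real) \<Rightarrow> (4 \<Rightarrow> 4 \<Rightarrow> real \<Rightarrow> real) \<Rightarrow> real ^ 4 \<Rightarrow> real ^ 4" where
  "brinkmann_map h M z = (let v = z $ 0; u = z $ 1 in
     vec4 u
       (v - 1/2 * (\<Sum>i\<in>{2,3}. \<Sum>j\<in>{2,3}. \<Sum>k\<in>{2,3}. \<Sum>l\<in>{2,3}.
          h i j u * deriv (M i k) u * M j l u * z $ k * z $ l))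
       (\<Sum>j\<in>{2,3}. M 2 j u * z $ j)
       (\<Sum>j\<in>{2,3}. M 3 j u * z $ j))"

definition brinkmann_metric ::
  "(4 \<Rightarrow> 4 \<Rightarrow> real \<Rightarrow> real) \<Rightarrow> (4 \<Rightarrow> 4 \<Rightarrow> real \<Rightarrow> real) \<Rightarrow> real ^ 4 \<Rightarrow> real ^ 4 ^ 4" where
  "brinkmann_metric h M z = (let u = z $ 1;
       H = - (\<Sum>j\<in>{2,3}. \<Sum>k\<in>{2,3}. \<Sum>l\<in>{2,3}.
              deriv (\<lambda>s. \<Sum>i\<in>{2,3}. h i j s * deriv (M i k) s) u * M j l u * z $ k * z $ l) in
     vec4 (vec4 0 1   0    0)
          (vec4 1 H   0    0)
          (vec4 0 0 (-1)   0)
          (vec4 0 0   0  (-1)))"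

end

theory Submission
  imports Defs
begin

text \<open>
  Near a boundary vector of the cone the fundamental tensor is the vertical Hessian of any smooth
  extension of \<open>L\<close>: two extensions agree on the open set \<open>A\<close>, so their second derivatives agree on its
  closure.  In lightlike coordinates \<open>N\<close> has constant components, so the components of \<open>g\<^sub>N\<close> arise from
  that Hessian by restriction to an affine slice and are smooth.  Parts (i) and (ii) then only need
  this smoothness and the special shape of the matrix.  For (iii), Gram-Schmidt gives a smooth
  \<open>h\<close>-orthonormal frame along the \<open>x\<^sup>0\<close>-axis; rotating it by an angle whose derivative cancels the
  antisymmetric part of the matrix \<open>h\<^sub>i\<^sub>j \<partial>\<^sub>uM\<^sup>i\<^sub>k M\<^sup>j\<^sub>l\<close> makes it symmetric.  Hence no linear matrix differential
  equation has to be solved, only an integral taken.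
\<close>


section \<open>Calculus of smooth maps\<close>

text \<open>A lightlike \<open>N\<close> lies where \<open>L\<close> vanishes, that is, on the
  frontier of the cone. So \<open>L\<close> carries no information on a full neighbourhood of
  \<open>N\<close>, and its Hessian there exists only through extensions. The fundamental tensor is
  therefore a definite description that must first be shown to be well defined, uniformly enough for
  one extension to serve all nearby points. In (iii) orthonormality of \<open>M\<close> makes the
  transverse block constant but leaves mixed terms du dx^k. Subtracting a quadratic form from v can
  cancel them only if their coefficients come from a symmetric matrix; this is the second condition
  on \<open>M\<close>. Orthonormal frames of equal orientation differ by a rotation of a plane, and
  plane rotations commute, so that condition is one scalar equation for the derivative of an
  angle.\<close>

lemma Ck_on_subset: "Ck_on k S f \<Longrightarrow> T \<subseteq> S \<Longrightarrow> Ck_on k T f"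
  by (induction k arbitrary: f) (auto intro: continuous_on_subset)

lemma Ck_on_cong:
  assumes "open S" "\<And>x. x \<in> S \<Longrightarrow> f x = g x" "Ck_on k S f"
  shows "Ck_on k S g"
  using assms(2,3)
proof (induction k arbitrary: f g)
  case 0
  then show ?case by (auto cong: continuous_on_cong)
next
  case (Suc k)
  have d: "f differentiable (at x)" if "x \<in> S" for x
    using Suc.prems(2) that by auto
  have e: "frechet_derivative f (at x) = frechet_derivative g (at x)" if "x \<in> S" for x
    by (rule frechet_derivative_transform_within_open[OF d[OF that] assms(1) that Suc.prems(1)])
  have "g differentiable (at x)" if x: "x \<in> S" for x
  proof -
    obtain D where "(f has_derivative D) (at x)" using d[OF x] differentiable_def by blast
    then have "(g has_derivative D) (at x)"
      by (rule has_derivative_transform_within_open[OF _ assms(1) x Suc.prems(1)])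
    then show ?thesis by (rule differentiableI)
  qed
  moreover have "Ck_on k S (\<lambda>x. frechet_derivative g (at x) v)" for v
    using Suc.IH[of "\<lambda>x. frechet_derivative f (at x) v" "\<lambda>x. frechet_derivative g (at x) v"]
      Suc.prems(2) e by auto
  ultimately show ?case by simp
qed

lemma Ck_on_SucD: "Ck_on (Suc k) S f \<Longrightarrow> Ck_on k S f"
proof (induction k arbitrary: f)
  case 0
  then show ?case
    by (auto intro!: continuous_at_imp_continuous_on differentiable_imp_continuous_within)
next
  case (Suc k)
  have "\<And>v. Ck_on k S (\<lambda>x. frechet_derivative f (at x) v)"
    by (rule Suc.IH) (use Suc.prems in simp)
  then show ?case using Suc.prems by simp
qed

text \<open>Lets an explicit derivative replace \<open>frechet_derivative\<close>, by uniqueness of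
  derivatives; openness of \<open>S\<close> makes the replacement harmless for the higher
  derivatives. The inductions for sums, products and compositions go through this rule.\<close>

lemma Ck_on_SucI:
  assumes "open S" "\<And>x. x \<in> S \<Longrightarrow> (f has_derivative f' x) (at x)"
    "\<And>v. Ck_on k S (\<lambda>x. f' x v)"
  shows "Ck_on (Suc k) S f"
proof -
  have "f' x = frechet_derivative f (at x)" if "x \<in> S" for x
    using frechet_derivative_at[OF assms(2)[OF that]] .
  then have "Ck_on k S (\<lambda>x. frechet_derivative f (at x) v)" for v
    using Ck_on_cong[OF assms(1) _ assms(3)] by simp
  then show ?thesis using assms(2) by (auto simp: differentiable_def)
qed

lemma Ck_on_SucE:
  assumes "Ck_on (Suc k) S f"
  shows "\<And>x. x \<in> S \<Longrightarrow> (f has_derivative frechet_derivative f (at x)) (at x)"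
    "\<And>v. Ck_on k S (\<lambda>x. frechet_derivative f (at x) v)"
  using assms by (auto simp: frechet_derivative_works)

text \<open>Needed because the components of g_N are smooth for a reason that changes from point to
  point: each point has its own extension of \<open>L\<close>.\<close>

lemma Ck_on_local:
  assumes "\<And>x. x \<in> S \<Longrightarrow> \<exists>U. open U \<and> x \<in> U \<and> Ck_on k U f"
  shows "Ck_on k S f"
  using assms
proof (induction k arbitrary: f)
  case 0
  have "isCont f x" if x: "x \<in> S" for x
  proof -
    obtain U where U: "open U" "x \<in> U" "Ck_on 0 U f" using 0[OF x] by blast
    then have "continuous_on U f" by simp
    then show ?thesis using U(1,2) by (simp add: continuous_on_eq_continuous_at)
  qed
  then show ?case by (simp add: continuous_at_imp_continuous_on)
next
  case (Suc k)
  have "Ck_on k S (\<lambda>x. frechet_derivative f (at x) v)" for v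
  proof (rule Suc.IH)
    fix x assume "x \<in> S"
    then obtain U where "open U" "x \<in> U" "Ck_on (Suc k) U f" using Suc.prems by blast
    then show "\<exists>U. open U \<and> x \<in> U \<and> Ck_on k U (\<lambda>x. frechet_derivative f (at x) v)"
      by (intro exI[of _ U]) simp
  qed
  moreover have "f differentiable (at x)" if x: "x \<in> S" for x
  proof -
    obtain U where "x \<in> U" "Ck_on (Suc k) U f" using Suc.prems[OF x] by blast
    then show ?thesis by simp
  qed
  ultimately show ?case by simp
qed

lemma smooth_on_subset: "smooth_on S f \<Longrightarrow> T \<subseteq> S \<Longrightarrow> smooth_on T f"
  unfolding smooth_on_def using Ck_on_subset by blast

lemma smooth_on_cong:
  "smooth_on S f \<Longrightarrow> open S \<Longrightarrow> (\<And>x. x \<in> S \<Longrightarrow> f x = g x) \<Longrightarrow> smooth_on S g"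
  unfolding smooth_on_def using Ck_on_cong by blast

lemma smooth_on_local:
  assumes "\<And>x. x \<in> S \<Longrightarrow> \<exists>U. open U \<and> x \<in> U \<and> smooth_on U f"
  shows "smooth_on S f"
  unfolding smooth_on_def
proof
  fix k show "Ck_on k S f"
    by (rule Ck_on_local) (use assms smooth_on_def in blast)
qed

lemma smooth_on_has_derivative:
  "smooth_on S f \<Longrightarrow> x \<in> S \<Longrightarrow> (f has_derivative frechet_derivative f (at x)) (at x)"
  unfolding smooth_on_def using Ck_on_SucE(1)[of 0] by blast

lemma smooth_on_frechet_derivative:
  "smooth_on S f \<Longrightarrow> smooth_on S (\<lambda>x. frechet_derivative f (at x) v)"
  unfolding smooth_on_def using Ck_on_SucE(2) by blast

lemma smooth_on_imp_continuous_on: "smooth_on S f \<Longrightarrow> continuous_on S f"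
  unfolding smooth_on_def by (metis Ck_on.simps(1))

lemma smooth_on_DERIV:
  fixes f :: "real \<Rightarrow> real"
  assumes "smooth_on S f" "x \<in> S"
  shows "(f has_real_derivative deriv f x) (at x)"
  using differentiableI[OF smooth_on_has_derivative[OF assms]]
  by (simp add: DERIV_deriv_iff_real_differentiable)

lemma smooth_on_deriv:
  fixes f :: "real \<Rightarrow> real"
  assumes "smooth_on S f" "open S"
  shows "smooth_on S (deriv f)"
proof (rule smooth_on_cong[OF smooth_on_frechet_derivative[OF assms(1), of 1] assms(2)])
  fix x assume "x \<in> S"
  then show "frechet_derivative f (at x) 1 = deriv f x"
    using frechet_derivative_at[OF smooth_on_DERIV[OF assms(1), unfolded has_field_derivative_def]]
    by (metis mult.right_neutral)
qed

section \<open>Algebra and composition of smooth maps\<close>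

lemma Ck_on_const: "Ck_on k S (\<lambda>x. c)"
proof (induction k arbitrary: c)
  case (Suc k)
  then show ?case by simp
qed simp

lemma Ck_on_bounded_linear:
  assumes "open S" "bounded_linear f" shows "Ck_on k S f"
proof (cases k)
  case 0
  then show ?thesis using assms by (simp add: linear_continuous_on)
next
  case (Suc k')
  show ?thesis unfolding Suc
    by (rule Ck_on_SucI[OF assms(1), of f "\<lambda>_. f"])
      (auto intro: bounded_linear_imp_has_derivative assms Ck_on_const)
qed

lemma Ck_on_add:
  assumes "open S" "Ck_on k S f" "Ck_on k S g"
  shows "Ck_on k S (\<lambda>x. f x + g x)"
  using assms(2,3)
proof (induction k arbitrary: f g)
  case 0
  then show ?case by (auto intro: continuous_intros)
next
  case (Suc k)
  show ?case
    by (rule Ck_on_SucI[OF assms(1) has_derivative_add[OF Ck_on_SucE(1) Ck_on_SucE(1)]])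
      (use Suc in auto)
qed

text \<open>The product rule also involves the undifferentiated factors, so the induction needs them
  at the lower order, which \<open>Ck_on_SucD\<close> supplies.\<close>

lemma Ck_on_scaleR:
  assumes "open S" "Ck_on k S f" "Ck_on k S g"
  shows "Ck_on k S (\<lambda>x. f x *\<^sub>R g x)"
  using assms(2,3)
proof (induction k arbitrary: f g)
  case 0
  then show ?case by (auto intro: continuous_intros)
next
  case (Suc k)
  have "Ck_on k S f" "Ck_on k S g" using Suc.prems Ck_on_SucD by blast+
  then show ?case
    by (intro Ck_on_SucI[OF assms(1) has_derivative_scaleR[OF Ck_on_SucE(1) Ck_on_SucE(1)]]
        Ck_on_add[OF assms(1)] Suc.IH)
      (use Suc.prems in auto)
qed

lemma Ck_on_sum:
  assumes "open S" "\<And>i. i \<in> I \<Longrightarrow> Ck_on k S (f i)"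
  shows "Ck_on k S (\<lambda>x. \<Sum>i\<in>I. f i x)"
  using assms(2)
  by (induction I rule: infinite_finite_induct) (auto intro: Ck_on_const Ck_on_add[OF assms(1)])

lemma Ck_on_bounded_linear_comp:
  assumes "open S" "bounded_linear T" "Ck_on k S f"
  shows "Ck_on k S (\<lambda>x. T (f x))"
  using assms(3)
proof (induction k arbitrary: f)
  case 0
  then show ?case using assms(2) by (auto intro: bounded_linear.continuous_on)
next
  case (Suc k)
  show ?case
    by (rule Ck_on_SucI[OF assms(1) bounded_linear.has_derivative[OF assms(2) Ck_on_SucE(1)]])
      (use Suc in auto)
qed

lemma smooth_on_const: "smooth_on S (\<lambda>x. c)"
  by (simp add: smooth_on_def Ck_on_const)

lemma smooth_on_linear:
  assumes "open S" "linear f" shows "smooth_on S f"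
  unfolding smooth_on_def
  by (intro allI Ck_on_bounded_linear[OF assms(1)]) (simp add: assms(2) flip: linear_conv_bounded_linear)

lemma smooth_on_add:
  "open S \<Longrightarrow> smooth_on S f \<Longrightarrow> smooth_on S g \<Longrightarrow> smooth_on S (\<lambda>x. f x + g x)"
  by (simp add: smooth_on_def Ck_on_add)

lemma smooth_on_scaleR:
  "open S \<Longrightarrow> smooth_on S f \<Longrightarrow> smooth_on S g \<Longrightarrow> smooth_on S (\<lambda>x. f x *\<^sub>R g x)"
  by (simp add: smooth_on_def Ck_on_scaleR)

lemma smooth_on_mult:
  fixes f g :: "'e::euclidean_space \<Rightarrow> real"
  shows "open S \<Longrightarrow> smooth_on S f \<Longrightarrow> smooth_on S g \<Longrightarrow> smooth_on S (\<lambda>x. f x * g x)"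
  using smooth_on_scaleR[of S f g] by simp

lemma smooth_on_sum:
  "open S \<Longrightarrow> (\<And>i. i \<in> I \<Longrightarrow> smooth_on S (f i)) \<Longrightarrow> smooth_on S (\<lambda>x. \<Sum>i\<in>I. f i x)"
  by (simp add: smooth_on_def Ck_on_sum)

lemma smooth_on_linear_comp:
  fixes f :: "'e::euclidean_space \<Rightarrow> 'f::euclidean_space"
    and T :: "'f \<Rightarrow> 'g::real_normed_vector"
  assumes "open S" "linear T" "smooth_on S f" shows "smooth_on S (\<lambda>x. T (f x))"
proof -
  have "bounded_linear T" using assms(2) linear_conv_bounded_linear by blast
  then show ?thesis
    using assms(3) Ck_on_bounded_linear_comp[OF assms(1), of T] unfolding smooth_on_def by auto
qed

lemma smooth_on_minus:
  fixes f :: "'e::euclidean_space \<Rightarrow> 'f::euclidean_space"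
  shows "open S \<Longrightarrow> smooth_on S f \<Longrightarrow> smooth_on S (\<lambda>x. - f x)"
  by (rule smooth_on_linear_comp[OF _ bounded_linear.linear[OF bounded_linear_minus[OF bounded_linear_ident]]])

lemma smooth_on_diff:
  fixes f :: "'e::euclidean_space \<Rightarrow> 'f::euclidean_space"
  shows "open S \<Longrightarrow> smooth_on S f \<Longrightarrow> smooth_on S g \<Longrightarrow> smooth_on S (\<lambda>x. f x - g x)"
  using smooth_on_add[OF _ _ smooth_on_minus, of S f g] by simp

lemma linear_euclidean_expand:
  fixes v :: "'e::euclidean_space"
  assumes "linear D" shows "D v = (\<Sum>b\<in>Basis. (v \<bullet> b) *\<^sub>R D b)"
proof -
  have "D v = D (\<Sum>b\<in>Basis. (v \<bullet> b) *\<^sub>R b)" by (simp add: euclidean_representation)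
  also have "\<dots> = (\<Sum>b\<in>Basis. (v \<bullet> b) *\<^sub>R D b)"
    by (simp add: linear_sum[OF assms] linear_scale[OF assms])
  finally show ?thesis .
qed

text \<open>By the chain rule the derivative of a composition is a sum of products of components of
  \<open>D f\<close> with functions \<open>(\<partial>\<^sub>b g) \<circ> f\<close>, which are compositions again.\<close>

lemma smooth_on_compose:
  fixes f :: "'e::euclidean_space \<Rightarrow> 'f::euclidean_space"
    and g :: "'f \<Rightarrow> 'g::real_normed_vector"
  assumes "open S" "open T" "smooth_on S f" "smooth_on T g" "f ` S \<subseteq> T"
  shows "smooth_on S (\<lambda>x. g (f x))"
  unfolding smooth_on_def
proof
  fix k
  show "Ck_on k S (\<lambda>x. g (f x))"
    using assms(4)
  proof (induction k arbitrary: g)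
    case 0
    then show ?case
      using assms(3,5) by (auto intro: continuous_on_compose2[OF smooth_on_imp_continuous_on
            smooth_on_imp_continuous_on])
  next
    case (Suc k)
    let ?g = "\<lambda>y. frechet_derivative g (at y)" and ?f = "\<lambda>x. frechet_derivative f (at x)"
    have f: "(f has_derivative ?f x) (at x)" if "x \<in> S" for x
      using smooth_on_has_derivative assms(3) that by blast
    have g: "(g has_derivative ?g (f x)) (at (f x))" if "x \<in> S" for x
      using smooth_on_has_derivative Suc.prems that assms(5) by blast
    \<comment> \<open>\<open>Ck_on\<close> tests derivatives in fixed directions only, whereas here
      the derivative of \<open>g\<close> is applied to a vector that moves with x. Expanding that
      vector in the basis leaves fixed directions with smooth coefficients.\<close>
    have "((\<lambda>x. g (f x)) has_derivative (\<lambda>v. \<Sum>b\<in>Basis. (?f x v \<bullet> b) *\<^sub>R ?g (f x) b)) (at x)"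
      if "x \<in> S" for x
    proof -
      have "linear (?g (f x))"
        using has_derivative_bounded_linear[OF g[OF that]] bounded_linear.linear by blast
      then have "(\<lambda>v. \<Sum>b\<in>Basis. (?f x v \<bullet> b) *\<^sub>R ?g (f x) b) = (\<lambda>v. ?g (f x) (?f x v))"
        by (intro ext linear_euclidean_expand[symmetric])
      then show ?thesis
        using has_derivative_compose[OF f[OF that] g[OF that]] by simp
    qed
    moreover have "Ck_on k S (\<lambda>x. \<Sum>b\<in>Basis. (?f x v \<bullet> b) *\<^sub>R ?g (f x) b)" for v
    proof (intro Ck_on_sum[OF assms(1)] Ck_on_scaleR[OF assms(1)])
      fix b :: 'f
      have "Ck_on k S (\<lambda>x. ?f x v)"
        using smooth_on_frechet_derivative[OF assms(3)] smooth_on_def by blast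
      then show "Ck_on k S (\<lambda>x. ?f x v \<bullet> b)"
        by (rule Ck_on_bounded_linear_comp[OF assms(1) bounded_linear_inner_left])
      show "Ck_on k S (\<lambda>x. ?g (f x) b)"
        using Suc.IH smooth_on_frechet_derivative[OF Suc.prems] by blast
    qed
    ultimately show ?case by (rule Ck_on_SucI[OF assms(1)])
  qed
qed

text \<open>Differentiation lowers the exponent by one, so the induction must leave \<open>a\<close>
  arbitrary. The exponents 1/2 and -1/2 supply the roots in Gram-Schmidt.\<close>

lemma smooth_on_powr: "smooth_on {0<..} (\<lambda>x::real. x powr (a::real))"
  unfolding smooth_on_def
proof
  fix k show "Ck_on k {0<..} (\<lambda>x::real. x powr (a::real))"
  proof (induction k arbitrary: a)
    case 0
    then show ?case by (auto intro!: continuous_intros)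
  next
    case (Suc k)
    have "((\<lambda>x::real. x powr a) has_derivative (\<lambda>v. (v * a) *\<^sub>R x powr (a - 1))) (at x)"
      if "x \<in> {0<..}" for x
    proof -
      have "(\<lambda>v. (v * a) *\<^sub>R x powr (a - 1)) = (*) (a * x powr (a - 1))"
        by (simp add: fun_eq_iff)
      then show ?thesis
        using has_real_derivative_powr[of x a] that by (simp add: has_field_derivative_def)
    qed
    moreover have "Ck_on k {0<..} (\<lambda>x::real. (v * a) *\<^sub>R x powr (a - 1))" for v
      by (intro Ck_on_scaleR Ck_on_const Suc open_greaterThan)
    ultimately show ?case by (rule Ck_on_SucI[OF open_greaterThan])
  qed
qed

text \<open>The span of sine and cosine is closed under differentiation, so an induction with
  arbitrary coefficients handles both at once.\<close>

lemma smooth_on_sin_cos: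
  "smooth_on UNIV (sin :: real \<Rightarrow> real)" "smooth_on UNIV (cos :: real \<Rightarrow> real)"
proof -
  have "Ck_on k UNIV (\<lambda>x::real. a *\<^sub>R sin x + b *\<^sub>R cos x)" for k a b
  proof (induction k arbitrary: a b)
    case 0
    then show ?case by (auto intro!: continuous_intros)
  next
    case (Suc k)
    have "((\<lambda>x::real. a *\<^sub>R sin x + b *\<^sub>R cos x) has_derivative
        (\<lambda>v. (- v * b) *\<^sub>R sin x + (v * a) *\<^sub>R cos x)) (at x)" for x
      by (auto intro!: derivative_eq_intros simp: algebra_simps)
    moreover have "Ck_on k UNIV (\<lambda>x::real. (- v * b) *\<^sub>R sin x + (v * a) *\<^sub>R cos x)" for v
      by (rule Suc)
    ultimately show ?case by (rule Ck_on_SucI[OF open_UNIV])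
  qed
  from this[of _ 1 0] this[of _ 0 1]
  show "smooth_on UNIV (sin :: real \<Rightarrow> real)" "smooth_on UNIV (cos :: real \<Rightarrow> real)"
    by (auto simp: smooth_on_def)
qed


section \<open>Charts of the tangent bundle\<close>

definition bundle_chart ::
  "'a topology \<Rightarrow> ('a, 'e::euclidean_space) chart set \<Rightarrow> ('a, 'e) chart
     \<Rightarrow> ('a \<times> ('a, 'e) tvec, 'e \<times> 'e) chart" where
  "bundle_chart X \<A> c =
     ({w \<in> tangent_bundle X \<A>. fst w \<in> fst c}, \<lambda>w. (snd c (fst w), snd w c))"

text \<open>Explicit inverse of \<open>bundle_chart X \<A> c\<close>. Over the image of the chart it
  replaces the choice hidden in \<open>chart_inv\<close>; calculus on \<open>TM\<close> is done
  after composing with it.\<close>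

definition bundle_param ::
  "('a, 'e::euclidean_space) chart set \<Rightarrow> ('a, 'e) chart \<Rightarrow> 'e \<times> 'e \<Rightarrow> 'a \<times> ('a, 'e) tvec" where
  "bundle_param \<A> c z = (chart_inv c (fst z), coord_vec \<A> c (chart_inv c (fst z)) (snd z))"

lemma bundle_atlas_eq: "bundle_atlas X \<A> = bundle_chart X \<A> ` \<A>"
  by (simp add: bundle_atlas_def bundle_chart_def)

lemma bundle_topology_eq:
  "bundle_topology X \<A> = topology_generated_by
     {{w \<in> fst (bundle_chart X \<A> c). snd (bundle_chart X \<A> c) w \<in> Q} | c Q. c \<in> \<A> \<and> open Q}"
  unfolding bundle_topology_def bundle_atlas_eq by (rule arg_cong) blast

locale manifold =
  fixes X :: "'a topology" and \<A> :: "('a, 'e::euclidean_space) chart set"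
  assumes manifold: "smooth_manifold X \<A>"
begin

lemma chart: "c \<in> \<A> \<Longrightarrow> is_chart X c"
  using manifold by (simp add: smooth_manifold_def)

lemma openin_chart_domain: "c \<in> \<A> \<Longrightarrow> openin X (fst c)"
  using chart by (auto simp: is_chart_def)

lemma chart_domain_subset: "c \<in> \<A> \<Longrightarrow> fst c \<subseteq> topspace X"
  using openin_chart_domain openin_subset by blast

lemma open_chart_image: "c \<in> \<A> \<Longrightarrow> open (snd c ` fst c)"
  using chart by (auto simp: is_chart_def)

lemma chart_inj: "c \<in> \<A> \<Longrightarrow> inj_on (snd c) (fst c)"
  using chart[of c] chart_domain_subset[of c]
  by (auto simp: is_chart_def Int_absorb1 dest!: homeomorphic_imp_injective_map)

lemma chart_inv_chart [simp]: "c \<in> \<A> \<Longrightarrow> p \<in> fst c \<Longrightarrow> chart_inv c (snd c p) = p"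
  by (simp add: chart_inv_def chart_inj)

lemma chart_inv_in: "x \<in> snd c ` fst c \<Longrightarrow> chart_inv c x \<in> fst c"
  unfolding chart_inv_def by (rule inv_into_into)

lemma chart_chart_inv [simp]: "x \<in> snd c ` fst c \<Longrightarrow> snd c (chart_inv c x) = x"
  unfolding chart_inv_def by (rule f_inv_into_f)

lemma open_chart_overlap:
  assumes "c \<in> \<A>" "d \<in> \<A>" shows "open (snd c ` (fst c \<inter> fst d))"
proof -
  have "openin (subtopology X (fst c)) (fst c \<inter> fst d)"
    using openin_chart_domain[OF assms(2)] openin_subtopology_Int2 by blast
  moreover have "homeomorphic_map (subtopology X (fst c)) (top_of_set (snd c ` fst c)) (snd c)"
    using chart[OF assms(1)] by (simp add: is_chart_def)
  ultimately have "openin (top_of_set (snd c ` fst c)) (snd c ` (fst c \<inter> fst d))"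
    using homeomorphic_imp_open_map open_map_def by blast
  then show ?thesis
    using open_chart_image[OF assms(1)] openin_open_eq by blast
qed

lemma smooth_on_transition:
  "c \<in> \<A> \<Longrightarrow> d \<in> \<A> \<Longrightarrow> smooth_on (snd c ` (fst c \<inter> fst d)) (snd d \<circ> chart_inv c)"
  using manifold by (simp add: smooth_manifold_def compatible_charts_def)

abbreviation transition_deriv ::
  "('a, 'e) chart \<Rightarrow> ('a, 'e) chart \<Rightarrow> 'a \<Rightarrow> 'e \<Rightarrow> 'e" where
  "transition_deriv c d p \<equiv> frechet_derivative (snd d \<circ> chart_inv c) (at (snd c p))"

lemma has_derivative_transition:
  assumes "c \<in> \<A>" "d \<in> \<A>" "p \<in> fst c" "p \<in> fst d"
  shows "((snd d \<circ> chart_inv c) has_derivative transition_deriv c d p) (at (snd c p))"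
  using smooth_on_has_derivative[OF smooth_on_transition[OF assms(1,2)]] assms by blast

lemma linear_transition_deriv:
  assumes "c \<in> \<A>" "d \<in> \<A>" "p \<in> fst c" "p \<in> fst d"
  shows "linear (transition_deriv c d p)"
  using has_derivative_transition[OF assms] has_derivative_linear by blast

lemma transition_deriv_refl:
  assumes "c \<in> \<A>" "p \<in> fst c" shows "transition_deriv c c p y = y"
proof -
  have "(id has_derivative id) (at (snd c p))" by (simp add: id_def)
  then have "((snd c \<circ> chart_inv c) has_derivative id) (at (snd c p))"
    by (rule has_derivative_transform_within_open[OF _ open_chart_image[OF assms(1)]])
      (use assms in auto)
  from frechet_derivative_at[OF this] show ?thesis by (metis id_apply)
qed

text \<open>Chain rule; the composed coordinate change agrees with the direct one only on the
  overlap, which is open. This cocycle identity is what makes \<open>coord_vec\<close> a tangent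
  vector.\<close>

lemma transition_deriv_trans:
  assumes "c \<in> \<A>" "d \<in> \<A>" "e \<in> \<A>" "p \<in> fst c" "p \<in> fst d" "p \<in> fst e"
  shows "transition_deriv d e p (transition_deriv c d p y) = transition_deriv c e p y"
proof -
  have p: "(snd d \<circ> chart_inv c) (snd c p) = snd d p" using assms by simp
  let ?D = "transition_deriv d e p \<circ> transition_deriv c d p"
  have "(((snd e \<circ> chart_inv d) \<circ> (snd d \<circ> chart_inv c)) has_derivative ?D) (at (snd c p))"
    by (rule diff_chain_at[OF has_derivative_transition])
      (use assms has_derivative_transition[of d e p] p in auto)
  then have "((snd e \<circ> chart_inv c) has_derivative ?D) (at (snd c p))"
    by (rule has_derivative_transform_within_open[OF _ open_chart_overlap[OF assms(1,2)]])
      (use assms in auto)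
  from frechet_derivative_at[OF this] show ?thesis by (metis comp_apply)
qed

lemma coord_vec_self: "c \<in> \<A> \<Longrightarrow> p \<in> fst c \<Longrightarrow> coord_vec \<A> c p y c = y"
  by (simp add: coord_vec_def transition_deriv_refl)

lemma coord_vec_in_tangent_space:
  "c \<in> \<A> \<Longrightarrow> p \<in> fst c \<Longrightarrow> coord_vec \<A> c p y \<in> tangent_space \<A> p"
  by (auto simp: tangent_space_def coord_vec_def transition_deriv_trans)

text \<open>The transformation law fixes \<open>v\<close> in every chart around \<open>p\<close>,
  and in all other charts both sides take the default value 0. So a tangent vector is determined by
  its components in one chart.\<close>

lemma tangent_vec_eq_coord_vec:
  assumes "c \<in> \<A>" "p \<in> fst c" "v \<in> tangent_space \<A> p"
  shows "coord_vec \<A> c p (v c) = v"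
proof
  fix d
  show "coord_vec \<A> c p (v c) d = v d"
  proof (cases "d \<in> \<A> \<and> p \<in> fst d")
    case True
    then have "v d = transition_deriv c d p (v c)"
      using assms unfolding tangent_space_def by blast
    then show ?thesis using True by (simp add: coord_vec_def)
  next
    case False
    then have "v d = 0" using assms(3) unfolding tangent_space_def by blast
    then show ?thesis using False by (auto simp: coord_vec_def)
  qed
qed

lemma coord_vec_linear_combination:
  assumes "c \<in> \<A>" "p \<in> fst c"
  shows "coord_vec \<A> c p (y + t *\<^sub>R a + s *\<^sub>R b)
    = (\<lambda>d. coord_vec \<A> c p y d + t *\<^sub>R coord_vec \<A> c p a d + s *\<^sub>R coord_vec \<A> c p b d)"
proof
  fix d
  show "coord_vec \<A> c p (y + t *\<^sub>R a + s *\<^sub>R b) d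
    = coord_vec \<A> c p y d + t *\<^sub>R coord_vec \<A> c p a d + s *\<^sub>R coord_vec \<A> c p b d"
  proof (cases "d \<in> \<A> \<and> p \<in> fst d")
    case True
    then have "linear (transition_deriv c d p)"
      using linear_transition_deriv assms by blast
    then show ?thesis using True by (simp add: coord_vec_def linear_add linear_scale)
  qed (auto simp: coord_vec_def)
qed

lemma coord_vec_eq_0_iff:
  assumes "c \<in> \<A>" "p \<in> fst c" shows "coord_vec \<A> c p y = (\<lambda>_. 0) \<longleftrightarrow> y = 0"
proof
  assume "coord_vec \<A> c p y = (\<lambda>_. 0)"
  then show "y = 0" using coord_vec_self[OF assms, of y] by simp
next
  assume "y = 0"
  then show "coord_vec \<A> c p y = (\<lambda>_. 0)"
    using linear_0[OF linear_transition_deriv[OF assms(1) _ assms(2)]]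
    by (simp add: coord_vec_def fun_eq_iff del: split_paired_All)
qed

section \<open>Bundle charts and the topology of the tangent bundle\<close>

lemma bundle_param_in_tangent_bundle:
  assumes "c \<in> \<A>" "fst z \<in> snd c ` fst c" shows "bundle_param \<A> c z \<in> tangent_bundle X \<A>"
  using chart_inv_in[OF assms(2)] chart_domain_subset[OF assms(1)]
    coord_vec_in_tangent_space[OF assms(1)]
  by (auto simp: bundle_param_def tangent_bundle_def)

lemma bundle_param_bundle_chart:
  assumes "c \<in> \<A>" "w \<in> fst (bundle_chart X \<A> c)"
  shows "bundle_param \<A> c (snd (bundle_chart X \<A> c) w) = w"
  using assms(2) tangent_vec_eq_coord_vec[OF assms(1)] chart_inv_chart[OF assms(1)]
  by (auto simp: bundle_chart_def bundle_param_def tangent_bundle_def)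

lemma bundle_chart_bundle_param:
  assumes "c \<in> \<A>" "fst z \<in> snd c ` fst c"
  shows "bundle_param \<A> c z \<in> fst (bundle_chart X \<A> c)"
    "snd (bundle_chart X \<A> c) (bundle_param \<A> c z) = z"
proof -
  show "bundle_param \<A> c z \<in> fst (bundle_chart X \<A> c)"
    using bundle_param_in_tangent_bundle[OF assms] chart_inv_in[OF assms(2)]
    by (simp add: bundle_chart_def bundle_param_def)
  show "snd (bundle_chart X \<A> c) (bundle_param \<A> c z) = z"
    using assms chart_inv_in[OF assms(2)]
    by (simp add: bundle_chart_def bundle_param_def coord_vec_self)
qed

lemma bundle_chart_image:
  assumes "c \<in> \<A>"
  shows "snd (bundle_chart X \<A> c) ` (W \<inter> fst (bundle_chart X \<A> c))
    = {z. fst z \<in> snd c ` fst c \<and> bundle_param \<A> c z \<in> W}" (is "?L = ?R")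
proof
  show "?L \<subseteq> ?R"
    using bundle_param_bundle_chart[OF assms] by (auto simp: bundle_chart_def)
  show "?R \<subseteq> ?L"
  proof
    fix z assume "z \<in> ?R"
    then show "z \<in> ?L"
      using bundle_chart_bundle_param[OF assms, of z]
      by (intro image_eqI[of _ _ "bundle_param \<A> c z"]) auto
  qed
qed

lemma chart_inv_bundle_chart:
  assumes "c \<in> \<A>" "fst z \<in> snd c ` fst c"
  shows "chart_inv (bundle_chart X \<A> c) z = bundle_param \<A> c z"
proof -
  have "inj_on (snd (bundle_chart X \<A> c)) (fst (bundle_chart X \<A> c))"
    using bundle_param_bundle_chart[OF assms(1)] by (rule inj_on_inverseI)
  then show ?thesis
    unfolding chart_inv_def using bundle_chart_bundle_param[OF assms] by (metis inv_into_f_f)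
qed

text \<open>Smoothness of the transition map gives continuity of its derivative in each fixed
  direction. Joint continuity in point and vector follows by expanding the vector in the
  basis.\<close>

lemma continuous_on_bundle_transition:
  assumes "c \<in> \<A>" "d \<in> \<A>"
  shows "continuous_on (snd c ` (fst c \<inter> fst d) \<times> UNIV)
    (\<lambda>z. ((snd d \<circ> chart_inv c) (fst z),
      frechet_derivative (snd d \<circ> chart_inv c) (at (fst z)) (snd z)))"
    (is "continuous_on (?S \<times> _) (\<lambda>z. (?\<tau> (fst z), ?D (fst z) (snd z)))")
proof -
  note smooth = smooth_on_transition[OF assms]
  have "continuous_on (?S \<times> UNIV) (\<lambda>z. ?\<tau> (fst z))"
    by (rule continuous_on_compose2[OF smooth_on_imp_continuous_on[OF smooth]
          continuous_on_fst[OF continuous_on_id]]) auto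
  moreover have "continuous_on (?S \<times> UNIV) (\<lambda>z. \<Sum>b\<in>Basis. (snd z \<bullet> b) *\<^sub>R ?D (fst z) b)"
  proof (intro continuous_on_sum continuous_on_scaleR)
    fix b :: 'e
    show "continuous_on (?S \<times> UNIV) (\<lambda>z. ?D (fst z) b)"
      by (rule continuous_on_compose2[OF smooth_on_imp_continuous_on[OF
              smooth_on_frechet_derivative[OF smooth]] continuous_on_fst[OF continuous_on_id]]) auto
  qed (intro continuous_intros)
  moreover have "?D (fst z) (snd z) = (\<Sum>b\<in>Basis. (snd z \<bullet> b) *\<^sub>R ?D (fst z) b)"
    if "z \<in> ?S \<times> UNIV" for z
  proof (rule linear_euclidean_expand, rule has_derivative_linear)
    show "(?\<tau> has_derivative ?D (fst z)) (at (fst z))"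
      using that by (intro smooth_on_has_derivative[OF smooth]) auto
  qed
  ultimately have "continuous_on (?S \<times> UNIV) (\<lambda>z. ?D (fst z) (snd z))"
    by (simp cong: continuous_on_cong)
  with \<open>continuous_on (?S \<times> UNIV) (\<lambda>z. ?\<tau> (fst z))\<close> show ?thesis
    by (rule continuous_on_Pair)
qed

text \<open>This is continuity of \<open>bundle_param\<close>. The bundle topology is given by
  generators, so openness is checked by induction on generation; a generator from another chart
  \<open>d\<close> pulls back along the transition map of the two bundle charts.\<close>

lemma open_bundle_param_vimage:
  assumes c: "c \<in> \<A>" and W: "openin (bundle_topology X \<A>) W"
  shows "open {z. fst z \<in> snd c ` fst c \<and> bundle_param \<A> c z \<in> W}" (is "open (?P W)")
proof -
  let ?G = "{{w \<in> fst (bundle_chart X \<A> d). snd (bundle_chart X \<A> d) w \<in> Q} | d Q.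
    d \<in> \<A> \<and> open Q}"
  have "generate_topology_on ?G W"
    using W by (simp only: bundle_topology_eq openin_topology_generated_by_iff)
  then show ?thesis
  proof (induction rule: generate_topology_on.induct)
    case (Int U V)
    moreover have "?P (U \<inter> V) = ?P U \<inter> ?P V" by auto
    ultimately show ?case by auto
  next
    case (UN K)
    moreover have "?P (\<Union>K) = (\<Union>U\<in>K. ?P U)" by auto
    ultimately show ?case by auto
  next
    case (Basis U)
    then obtain d Q where d: "d \<in> \<A>" and Q: "open Q"
      and U: "U = {w \<in> fst (bundle_chart X \<A> d). snd (bundle_chart X \<A> d) w \<in> Q}"
      by blast
    let ?S = "snd c ` (fst c \<inter> fst d) \<times> (UNIV :: 'e set)"
    let ?T = "\<lambda>z. ((snd d \<circ> chart_inv c) (fst z),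
      frechet_derivative (snd d \<circ> chart_inv c) (at (fst z)) (snd z))"
    have "open (?S \<inter> ?T -` Q)"
      by (rule continuous_open_preimage[OF continuous_on_bundle_transition[OF c d]])
        (use open_chart_overlap[OF c d] Q in \<open>auto intro: open_Times\<close>)
    moreover have "?P U = ?S \<inter> ?T -` Q"
    proof (rule set_eqI)
      fix z :: "'e \<times> 'e"
      show "z \<in> ?P U \<longleftrightarrow> z \<in> ?S \<inter> ?T -` Q"
      proof (cases "fst z \<in> snd c ` fst c")
        case True
        let ?p = "chart_inv c (fst z)"
        have p: "?p \<in> fst c" "snd c ?p = fst z" 
          by (fact chart_inv_in[OF True] chart_chart_inv[OF True])+
        have S: "z \<in> ?S \<longleftrightarrow> ?p \<in> fst d"
        proof
          assume "z \<in> ?S"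
          then obtain q where "q \<in> fst c" "q \<in> fst d" "fst z = snd c q" by auto
          then show "?p \<in> fst d" using c by simp
        next
          assume "?p \<in> fst d"
          then have "fst z \<in> snd c ` (fst c \<inter> fst d)" using p by (metis IntI image_eqI)
          then show "z \<in> ?S" by (simp add: mem_Times_iff)
        qed
        have "?T z = snd (bundle_chart X \<A> d) (bundle_param \<A> c z)" if "?p \<in> fst d"
          using that d p by (simp add: bundle_chart_def bundle_param_def coord_vec_def)
        moreover have "z \<in> ?P U \<longleftrightarrow> ?p \<in> fst d \<and> snd (bundle_chart X \<A> d) (bundle_param \<A> c z) \<in> Q"
          using True bundle_param_in_tangent_bundle[OF c True]
          by (simp add: U bundle_chart_def bundle_param_def)
        ultimately show ?thesis using S by auto
      next
        case False
        then show ?thesis by auto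
      qed
    qed
    ultimately show ?case by simp
  qed simp
qed

lemma openin_bundle_chart_vimage:
  assumes "c \<in> \<A>" "open Q"
  shows "openin (bundle_topology X \<A>)
    {w \<in> fst (bundle_chart X \<A> c). snd (bundle_chart X \<A> c) w \<in> Q}"
  unfolding bundle_topology_eq
  by (rule topology_generated_by_Basis) (use assms in blast)

end


section \<open>Smoothness of the fundamental tensor\<close>

definition vertical_hessian ::
  "('e::euclidean_space \<times> 'e \<Rightarrow> real) \<Rightarrow> 'e \<times> 'e \<Rightarrow> 'e \<Rightarrow> 'e \<Rightarrow> real" where
  "vertical_hessian f z a b =
     frechet_derivative (\<lambda>z. frechet_derivative f (at z) (0, a)) (at z) (0, b)"

lemma smooth_on_vertical_hessian:
  "smooth_on S f \<Longrightarrow> smooth_on S (\<lambda>z. vertical_hessian f z a b)"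
  unfolding vertical_hessian_def by (intro smooth_on_frechet_derivative)

lemma smooth_on_directional_derivative:
  fixes g :: "'e::euclidean_space \<Rightarrow> real"
  assumes "smooth_on S g" "z \<in> S"
  shows "((\<lambda>t. g (z + t *\<^sub>R w)) has_real_derivative frechet_derivative g (at z) w) (at 0)"
proof -
  let ?D = "frechet_derivative g (at z)"
  have g: "(g has_derivative ?D) (at z)"
    by (rule smooth_on_has_derivative[OF assms])
  have "((\<lambda>t. z + t *\<^sub>R w) has_derivative (\<lambda>t. t *\<^sub>R w)) (at 0)"
    by (auto intro!: derivative_eq_intros)
  moreover have "(g has_derivative ?D) (at (z + 0 *\<^sub>R w))" using g by simp
  ultimately have "((\<lambda>t. g (z + t *\<^sub>R w)) has_derivative (\<lambda>t. ?D (t *\<^sub>R w))) (at 0)"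
    by (rule has_derivative_compose)
  moreover have "(\<lambda>t. ?D (t *\<^sub>R w)) = (*) (?D w)"
    using linear_scale[OF has_derivative_linear[OF g]] by (auto simp: mult.commute)
  ultimately show ?thesis by (simp add: has_field_derivative_def)
qed

lemma deriv_deriv_eq_vertical_hessian:
  assumes "open S" "smooth_on S f" "(x, y) \<in> S"
  shows "deriv (\<lambda>s. deriv (\<lambda>t. f (x, y + t *\<^sub>R a + s *\<^sub>R b)) 0) 0 = vertical_hessian f (x, y) a b"
proof -
  let ?g = "\<lambda>z. frechet_derivative f (at z) (0, a)"
  \<comment> \<open>The inner derivative is known only where the shifted base point stays in
    \<open>S\<close>. This holds for \<open>s\<close> near 0, which is all that the outer derivative
    at 0 sees.\<close>
  have "open ((\<lambda>s::real. (x, y) + s *\<^sub>R (0, b)) -` S)"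
    by (intro open_vimage assms(1) continuous_intros)
  from eventually_nhds_in_open[OF this, of 0]
  have "\<forall>\<^sub>F s in nhds 0. (x, y) + s *\<^sub>R (0, b) \<in> S"
    using assms(3) by simp
  then have "\<forall>\<^sub>F s in nhds 0. deriv (\<lambda>t. f (x, y + t *\<^sub>R a + s *\<^sub>R b)) 0 = ?g ((x, y) + s *\<^sub>R (0, b))"
  proof eventually_elim
    case (elim s)
    from smooth_on_directional_derivative[OF assms(2) elim, of "(0, a)"]
    show ?case by (intro DERIV_imp_deriv) (simp add: algebra_simps)
  qed
  then have "deriv (\<lambda>s. deriv (\<lambda>t. f (x, y + t *\<^sub>R a + s *\<^sub>R b)) 0) 0
      = deriv (\<lambda>s. ?g ((x, y) + s *\<^sub>R (0, b))) 0"
    by (intro deriv_cong_ev) auto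
  also have "\<dots> = vertical_hessian f (x, y) a b"
    unfolding vertical_hessian_def
    by (intro DERIV_imp_deriv
        smooth_on_directional_derivative[OF smooth_on_frechet_derivative[OF assms(2)] assms(3)])
  finally show ?thesis .
qed

lemma continuous_agree_at_adherent_point:
  fixes f g :: "'e::topological_space \<Rightarrow> real"
  assumes "open S" "continuous_on S f" "continuous_on S g" "z \<in> S"
    and "\<And>w. w \<in> U \<Longrightarrow> f w = g w"
    and "\<And>Q. open Q \<Longrightarrow> z \<in> Q \<Longrightarrow> Q \<inter> U \<noteq> {}"
  shows "f z = g z"
proof (rule ccontr)
  assume "f z \<noteq> g z"
  let ?Q = "S \<inter> (\<lambda>w. f w - g w) -` (- {0})"
  have "open ?Q"
    by (rule continuous_open_preimage[OF _ assms(1)]) (auto intro: continuous_on_diff assms)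
  moreover have "z \<in> ?Q" using \<open>f z \<noteq> g z\<close> assms(4) by auto
  ultimately have "?Q \<inter> U \<noteq> {}" by (rule assms(6))
  then show False using assms(5) by auto
qed

lemma vertical_hessian_cong_open:
  assumes "open U" "smooth_on U f" "\<And>w. w \<in> U \<Longrightarrow> f w = g w" "z \<in> U"
  shows "vertical_hessian f z a b = vertical_hessian g z a b"
proof -
  have *: "frechet_derivative f (at w) (0, a) = frechet_derivative g (at w) (0, a)" if "w \<in> U" for w
    by (rule arg_cong[OF frechet_derivative_transform_within_open[OF
          differentiableI[OF smooth_on_has_derivative[OF assms(2) that]] assms(1) that assms(3)], of "\<lambda>D. D (0,a)"])
  show ?thesis
    unfolding vertical_hessian_def
    by (rule arg_cong[OF frechet_derivative_transform_within_open[OF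
          differentiableI[OF smooth_on_has_derivative[OF smooth_on_frechet_derivative[OF assms(2)]
            assms(4)]] assms(1,4) *], of "\<lambda>D. D (0,b)"])
qed

context manifold
begin

lemma local_extension_in_chart:
  assumes "c \<in> \<A>"
    and "local_extension (bundle_topology X \<A>) (bundle_atlas X \<A>) S L w W F"
  shows "smooth_on {z. fst z \<in> snd c ` fst c \<and> bundle_param \<A> c z \<in> W}
    (\<lambda>z. F (bundle_param \<A> c z))" (is "smooth_on ?O _")
proof -
  let ?b = "bundle_chart X \<A> c"
  have W: "openin (bundle_topology X \<A>) W" "smooth_on_open (bundle_atlas X \<A>) W F"
    using assms(2) by (auto simp: local_extension_def)
  have "?b \<in> bundle_atlas X \<A>" using assms(1) by (simp add: bundle_atlas_eq)
  then have "smooth_on (snd ?b ` (W \<inter> fst ?b)) (F \<circ> chart_inv ?b)"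
    using W(2) unfolding smooth_on_open_def by blast
  then have "smooth_on ?O (F \<circ> chart_inv ?b)"
    by (simp only: bundle_chart_image[OF assms(1)])
  then show ?thesis
    by (rule smooth_on_cong[OF _ open_bundle_param_vimage[OF assms(1) W(1)]])
      (use chart_inv_bundle_chart[OF assms(1)] in simp)
qed

lemma slit_point_in_chart:
  assumes "c \<in> \<A>" "p \<in> fst c" "(p, v) \<in> topspace (slit_topology X \<A>)"
  shows "v \<in> tangent_space \<A> p" "bundle_param \<A> c (snd c p, v c) = (p, v)"
proof -
  show v: "v \<in> tangent_space \<A> p"
    using assms(3) by (auto simp: slit_topology_def tangent_bundle_def)
  show "bundle_param \<A> c (snd c p, v c) = (p, v)"
    using tangent_vec_eq_coord_vec[OF assms(1,2) v] assms(1,2) by (simp add: bundle_param_def)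
qed

lemma bundle_param_in_slit:
  assumes "c \<in> \<A>" "fst z \<in> snd c ` fst c"
  shows "bundle_param \<A> c z \<in> tangent_bundle X \<A> - zero_section X \<longleftrightarrow> snd z \<noteq> 0"
  using bundle_param_in_tangent_bundle[OF assms] coord_vec_eq_0_iff[OF assms(1) chart_inv_in[OF assms(2)]]
    chart_domain_subset[OF assms(1)] chart_inv_in[OF assms(2)]
  by (auto simp: bundle_param_def zero_section_def)

lemma vertical_hessian_extension_unique:
  assumes c: "c \<in> \<A>" "p \<in> fst c" and A: "openin (slit_topology X \<A>) A"
    and v: "(p, v) \<in> conic_closure X \<A> A"
    and W1: "local_extension (bundle_topology X \<A>) (bundle_atlas X \<A>)
      (conic_closure X \<A> A) L (p, v) W1 F1"
    and W2: "local_extension (bundle_topology X \<A>) (bundle_atlas X \<A>)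
      (conic_closure X \<A> A) L (p, v) W2 F2"
  shows "vertical_hessian (\<lambda>z. F1 (bundle_param \<A> c z)) (snd c p, v c) a b
    = vertical_hessian (\<lambda>z. F2 (bundle_param \<A> c z)) (snd c p, v c) a b"
proof -
  let ?P = "\<lambda>W. {z. fst z \<in> snd c ` fst c \<and> bundle_param \<A> c z \<in> W}"
  let ?f1 = "\<lambda>z. F1 (bundle_param \<A> c z)" and ?f2 = "\<lambda>z. F2 (bundle_param \<A> c z)"
  let ?slit = "tangent_bundle X \<A> - zero_section X"
  let ?b = "bundle_chart X \<A> c"
  have opens: "openin (bundle_topology X \<A>) W1" "openin (bundle_topology X \<A>) W2"
    and mem: "(p, v) \<in> W1" "(p, v) \<in> W2"
    using W1 W2 by (auto simp: local_extension_def)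
  note open_P = open_bundle_param_vimage[OF c(1)]
  have s1: "smooth_on (?P W1 \<inter> ?P W2) ?f1"
    by (rule smooth_on_subset[OF local_extension_in_chart[OF c(1) W1]]) auto
  have s2: "smooth_on (?P W1 \<inter> ?P W2) ?f2"
    by (rule smooth_on_subset[OF local_extension_in_chart[OF c(1) W2]]) auto
  have top: "(p, v) \<in> topspace (slit_topology X \<A>)"
    using v unfolding conic_closure_def by (rule in_closure_of[THEN iffD1, THEN conjunct1])
  note pv = slit_point_in_chart[OF c top]
  obtain T where T: "openin (bundle_topology X \<A>) T" "A = T \<inter> ?slit"
    using A by (auto simp: slit_topology_def openin_subtopology)
  define U where "U = ?P W1 \<inter> ?P W2 \<inter> ?P A"
  \<comment> \<open>\<open>A\<close> is open only relative to the slit bundle. In coordinates the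
    zero section is the closed set \<open>snd z = 0\<close>, so the coordinate image of
    \<open>A\<close> is open all the same.\<close>
  have "?P A = ?P T \<inter> {z. snd z \<noteq> 0}"
    using bundle_param_in_slit[OF c(1)] T(2) by blast
  moreover have "open {z :: 'e \<times> 'e. snd z \<noteq> 0}"
    by (intro open_Collect_neq continuous_intros)
  ultimately have U: "open U"
    unfolding U_def by (simp only:) (intro open_Int open_P opens T(1))
  have agree: "?f1 z = ?f2 z" if "z \<in> U" for z
  proof -
    have "bundle_param \<A> c z \<in> conic_closure X \<A> A"
      using that closure_of_subset[OF openin_subset[OF A]] by (auto simp: U_def conic_closure_def)
    then show ?thesis
      using that W1 W2 by (auto simp: U_def local_extension_def)
  qed
  show ?thesis
  proof (rule continuous_agree_at_adherent_point[where S = "?P W1 \<inter> ?P W2" and U = U])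
    show "open (?P W1 \<inter> ?P W2)" using open_P opens by blast
    show "(snd c p, v c) \<in> ?P W1 \<inter> ?P W2" using c mem pv by simp
    show "vertical_hessian ?f1 z a b = vertical_hessian ?f2 z a b" if "z \<in> U" for z
      by (rule vertical_hessian_cong_open[OF U smooth_on_subset[OF s1] agree that])
        (auto simp: U_def)
    show "Q \<inter> U \<noteq> {}" if Q: "open Q" "(snd c p, v c) \<in> Q" for Q
    proof -
      \<comment> \<open>Adherence of \<open>(p, v)\<close> to \<open>A\<close> is known only in the
        topology of the bundle, so the coordinate neighbourhood \<open>Q\<close> is carried back
        there; the point of \<open>A\<close> found in it is then read in coordinates again.\<close>
      let ?V = "W1 \<inter> W2 \<inter> {w \<in> fst ?b. snd ?b w \<in> Q}"
      have closure: "\<exists>w. w \<in> A \<and> w \<in> T" if "(p, v) \<in> T" "openin (slit_topology X \<A>) T" for T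
        using v that unfolding conic_closure_def in_closure_of by simp
      have "openin (slit_topology X \<A>) (?slit \<inter> ?V)"
        unfolding slit_topology_def
        by (intro openin_subtopology_Int2 openin_Int opens openin_bundle_chart_vimage c Q)
      moreover have "(p, v) \<in> ?slit \<inter> ?V"
        using mem c Q(2) top by (auto simp: slit_topology_def bundle_chart_def)
      ultimately have "\<exists>w. w \<in> A \<and> w \<in> ?slit \<inter> ?V" by (intro closure)
      then obtain w where w: "w \<in> A" "w \<in> ?slit \<inter> ?V" by (elim exE conjE)
      have "bundle_param \<A> c (snd ?b w) = w"
        using bundle_param_bundle_chart[OF c(1)] w(2) by blast
      moreover have "fst (snd ?b w) \<in> snd c ` fst c"
        using w(2) by (auto simp: bundle_chart_def)
      ultimately have "snd ?b w \<in> Q \<inter> U"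
        using w by (simp add: U_def)
      then show ?thesis by blast
    qed
  qed (intro smooth_on_imp_continuous_on smooth_on_vertical_hessian s1 s2)+
qed

text \<open>Uniqueness of the Hessian resolves the definite description, so any extension may be
  used. In particular \<open>F\<close> can be kept while \<open>p\<close> and \<open>v\<close> vary,
  which turns a pointwise definition into a function that can be differentiated.\<close>

lemma fundamental_tensor_eq_vertical_hessian:
  assumes c: "c \<in> \<A>" "p \<in> fst c" and A: "openin (slit_topology X \<A>) A"
    and v: "(p, v) \<in> conic_closure X \<A> A"
    and ext: "local_extension (bundle_topology X \<A>) (bundle_atlas X \<A>)
      (conic_closure X \<A> A) L (p, v) W F"
  shows "fundamental_tensor X \<A> A L p v (coord_vec \<A> c p a) (coord_vec \<A> c p b)
    = 1/2 * vertical_hessian (\<lambda>z. F (bundle_param \<A> c z)) (snd c p, v c) a b"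
proof -
  have top: "(p, v) \<in> topspace (slit_topology X \<A>)"
    using v unfolding conic_closure_def by (rule in_closure_of[THEN iffD1, THEN conjunct1])
  note pv = slit_point_in_chart[OF c top]
  have *: "deriv (\<lambda>s. deriv (\<lambda>t. F' (p, \<lambda>d. v d + t *\<^sub>R coord_vec \<A> c p a d
        + s *\<^sub>R coord_vec \<A> c p b d)) 0) 0
      = vertical_hessian (\<lambda>z. F' (bundle_param \<A> c z)) (snd c p, v c) a b"
    if ext': "local_extension (bundle_topology X \<A>) (bundle_atlas X \<A>)
      (conic_closure X \<A> A) L (p, v) W' F'" for W' F'
  proof -
    have W': "openin (bundle_topology X \<A>) W'" "(p, v) \<in> W'"
      using ext' by (auto simp: local_extension_def)
    have "(p, \<lambda>d. v d + t *\<^sub>R coord_vec \<A> c p a d + s *\<^sub>R coord_vec \<A> c p b d)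
        = bundle_param \<A> c (snd c p, v c + t *\<^sub>R a + s *\<^sub>R b)" for t s
      using coord_vec_linear_combination[OF c] tangent_vec_eq_coord_vec[OF c pv(1)] c
      by (simp add: bundle_param_def)
    then show ?thesis
      using deriv_deriv_eq_vertical_hessian[OF open_bundle_param_vimage[OF c(1) W'(1)]
          local_extension_in_chart[OF c(1) ext']] c pv(2) W'(2) by simp
  qed
  show ?thesis
    unfolding fundamental_tensor_def
  proof (rule the_equality)
    fix r
    assume "\<exists>W F. local_extension (bundle_topology X \<A>) (bundle_atlas X \<A>)
        (conic_closure X \<A> A) L (p, v) W F \<and>
      r = 1/2 * deriv (\<lambda>s. deriv (\<lambda>t. F (p, \<lambda>d. v d + t *\<^sub>R coord_vec \<A> c p a d
        + s *\<^sub>R coord_vec \<A> c p b d)) 0) 0"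
    then obtain W' F' where ext': "local_extension (bundle_topology X \<A>) (bundle_atlas X \<A>)
        (conic_closure X \<A> A) L (p, v) W' F'"
      and r: "r = 1/2 * deriv (\<lambda>s. deriv (\<lambda>t. F' (p, \<lambda>d. v d + t *\<^sub>R coord_vec \<A> c p a d
        + s *\<^sub>R coord_vec \<A> c p b d)) 0) 0"
      by blast
    show "r = 1/2 * vertical_hessian (\<lambda>z. F (bundle_param \<A> c z)) (snd c p, v c) a b"
      unfolding r *[OF ext'] vertical_hessian_extension_unique[OF c A v ext' ext] ..
  qed (intro exI conjI, rule ext, simp only: *[OF ext])
qed

lemma smooth_on_metric_at_field:
  assumes c: "c \<in> \<A>" and A: "openin (slit_topology X \<A>) A"
    and L: "smooth_fun (bundle_topology X \<A>) (bundle_atlas X \<A>) (conic_closure X \<A> A) L"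
    and N: "\<And>p. p \<in> fst c \<Longrightarrow> (p, N p) \<in> conic_closure X \<A> A"
    and N_const: "\<And>p. p \<in> fst c \<Longrightarrow> N p = coord_vec \<A> c p e"
  shows "smooth_on (snd c ` fst c) (\<lambda>x. metric_at_field X \<A> A L N c x a b)"
proof (rule smooth_on_local)
  fix x assume x: "x \<in> snd c ` fst c"
  let ?p = "chart_inv c x"
  have p: "?p \<in> fst c" by (rule chart_inv_in[OF x])
  obtain W F where ext: "local_extension (bundle_topology X \<A>) (bundle_atlas X \<A>)
      (conic_closure X \<A> A) L (?p, N ?p) W F"
    using L N[OF p] unfolding smooth_fun_def by blast
  then have W: "openin (bundle_topology X \<A>) W" "(?p, N ?p) \<in> W"
    by (auto simp: local_extension_def)
  let ?O = "{z. fst z \<in> snd c ` fst c \<and> bundle_param \<A> c z \<in> W}"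
  let ?f = "\<lambda>z. F (bundle_param \<A> c z)"
  define U where "U = (\<lambda>y. (y, e)) -` ?O"
  have O: "open ?O" by (rule open_bundle_param_vimage[OF c W(1)])
  have U: "open U"
    unfolding U_def by (intro open_vimage O continuous_intros)
  have "linear (\<lambda>y::'e. (y, 0::'e))"
    by (intro linearI) auto
  from smooth_on_add[OF U smooth_on_linear[OF U this] smooth_on_const[of _ "(0, e)"]]
  have "smooth_on U (\<lambda>y. (y, e))" by simp
  then have "smooth_on U (\<lambda>y. vertical_hessian ?f (y, e) a b)"
    by (rule smooth_on_compose[OF U O _ smooth_on_vertical_hessian[OF local_extension_in_chart[OF c ext]]])
      (auto simp: U_def)
  then have "smooth_on U (\<lambda>y. 1/2 * vertical_hessian ?f (y, e) a b)"
    by (rule smooth_on_mult[OF U smooth_on_const])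
  then have "smooth_on U (\<lambda>y. metric_at_field X \<A> A L N c y a b)"
  proof (rule smooth_on_cong[OF _ U])
    fix y assume y: "y \<in> U"
    let ?q = "chart_inv c y"
    from y have yc: "y \<in> snd c ` fst c" and yW: "bundle_param \<A> c (y, e) \<in> W"
      by (auto simp only: U_def vimage_eq mem_Collect_eq fst_conv)
    have q: "?q \<in> fst c" by (rule chart_inv_in[OF yc])
    have "(?q, N ?q) = bundle_param \<A> c (y, e)"
      using N_const[OF q] by (simp add: bundle_param_def)
    \<comment> \<open>The base point enters \<open>local_extension\<close> only through membership
      in \<open>W\<close>, so the extension chosen at \<open>x\<close> is one at every point of
      \<open>U\<close>.\<close>
    then have "local_extension (bundle_topology X \<A>) (bundle_atlas X \<A>)
        (conic_closure X \<A> A) L (?q, N ?q) W F"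
      using ext yW by (simp add: local_extension_def)
    moreover have "N ?q c = e" using N_const[OF q] coord_vec_self[OF c q] by simp
    ultimately show "1/2 * vertical_hessian ?f (y, e) a b = metric_at_field X \<A> A L N c y a b"
      using fundamental_tensor_eq_vertical_hessian[OF c q A N[OF q], of L W F a b]
        chart_chart_inv[OF yc]
      by (simp add: metric_at_field_def Let_def)
  qed
  moreover have "x \<in> U"
    using x W(2) N_const[OF p] by (simp add: U_def bundle_param_def)
  ultimately show "\<exists>U. open U \<and> x \<in> U \<and> smooth_on U (\<lambda>y. metric_at_field X \<A> A L N c y a b)"
    using U by blast
qed

end


section \<open>The rescaled metrics and their limit\<close>

lemma smooth_on_euclideanI:
  fixes f :: "'e::euclidean_space \<Rightarrow> 'f::euclidean_space"
  assumes "open S" "\<And>b. b \<in> Basis \<Longrightarrow> smooth_on S (\<lambda>x. f x \<bullet> b)"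
  shows "smooth_on S f"
proof -
  have "smooth_on S (\<lambda>x. \<Sum>b\<in>Basis. (f x \<bullet> b) *\<^sub>R b)"
    by (intro smooth_on_sum smooth_on_scaleR smooth_on_const assms)
  then show ?thesis by (simp add: euclidean_representation)
qed

lemma smooth_on_vecI:
  fixes f :: "'e::euclidean_space \<Rightarrow> 'f::euclidean_space ^ 'n"
  assumes "open S" "\<And>i. smooth_on S (\<lambda>x. f x $ i)"
  shows "smooth_on S f"
proof (rule smooth_on_euclideanI[OF assms(1)])
  fix b :: "'f ^ 'n" assume "b \<in> Basis"
  then obtain i u where "b = axis i u" by (auto simp: Basis_vec_def)
  moreover have "linear (\<lambda>x. x \<bullet> u)"
    using bounded_linear_inner_left bounded_linear.linear by blast
  ultimately show "smooth_on S (\<lambda>x. f x \<bullet> b)"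
    using smooth_on_linear_comp[OF assms(1) _ assms(2)] by (simp add: inner_axis)
qed

lemma linear_vec_nth: "linear (\<lambda>x :: 'f::real_normed_vector ^ 'n. x $ i)"
  by (intro linearI) auto

lemma smooth_on_vec_nth:
  fixes f :: "'e::euclidean_space \<Rightarrow> 'f::euclidean_space ^ 'n"
  assumes "open S" "smooth_on S f"
  shows "smooth_on S (\<lambda>x. f x $ i)"
  by (rule smooth_on_linear_comp[OF assms(1) linear_vec_nth assms(2)])

lemma forall_4_from_0: "(\<forall>i::4. P i) \<longleftrightarrow> P 0 \<and> P 1 \<and> P 2 \<and> P 3"
proof -
  have "(4::4) = 0" by simp
  then show ?thesis by (metis forall_4)
qed

lemma sum_UNIV_4_from_0: "sum f (UNIV :: 4 set) = f 0 + f 1 + f 2 + (f 3 :: 'b::comm_monoid_add)"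
proof -
  have "f 4 = f 0" by (rule arg_cong[of _ _ f]) simp
  then show ?thesis unfolding sum_4 by (simp only: ac_simps)
qed

lemma vec4_nth [simp]:
  "vec4 a b c d $ 0 = a" "vec4 a b c d $ 1 = b" "vec4 a b c d $ 2 = c" "vec4 a b c d $ 3 = d"
  by (simp_all add: vec4_def)

lemma vec4_eq_iff: "v = w \<longleftrightarrow> v $ 0 = w $ 0 \<and> v $ 1 = w $ 1 \<and> v $ 2 = w $ 2 \<and> v $ 3 = w $ (3::4)"
  by (simp add: vec_eq_iff forall_4_from_0)

lemma smooth_on_vec4:
  fixes f0 f1 f2 f3 :: "'e::euclidean_space \<Rightarrow> 'f::euclidean_space"
  assumes "open S" "smooth_on S f0" "smooth_on S f1" "smooth_on S f2" "smooth_on S f3"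
  shows "smooth_on S (\<lambda>x. vec4 (f0 x) (f1 x) (f2 x) (f3 x))"
proof (rule smooth_on_vecI[OF assms(1)])
  have "\<forall>i. smooth_on S (\<lambda>x. vec4 (f0 x) (f1 x) (f2 x) (f3 x) $ i)"
    unfolding forall_4_from_0 using assms by simp
  then show "smooth_on S (\<lambda>x. vec4 (f0 x) (f1 x) (f2 x) (f3 x) $ i)" for i ..
qed

lemma sum_23: "sum f {2, 3::4} = f 2 + (f 3 :: 'b::comm_monoid_add)"
  by simp

lemma diffeomorphism_betweenI:
  assumes "open S" "open T" "smooth_on S f" "smooth_on T g"
    and "\<And>x. x \<in> S \<Longrightarrow> f x \<in> T" "\<And>y. y \<in> T \<Longrightarrow> g y \<in> S"
    and "\<And>x. x \<in> S \<Longrightarrow> g (f x) = x" and fg: "\<And>y. y \<in> T \<Longrightarrow> f (g y) = y"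
  shows "diffeomorphism_between S T f"
    and "\<And>y. y \<in> T \<Longrightarrow> inv_into S f y = g y"
proof -
  have bij: "bij_betw f S T"
    by (rule bij_betw_byWitness[of _ g]) (use assms in auto)
  show inv: "inv_into S f y = g y" if "y \<in> T" for y
    using inv_into_f_f[OF bij_betw_imp_inj_on[OF bij], of "g y"] assms(6) fg that by simp
  have "smooth_on T (inv_into S f)"
    by (rule smooth_on_cong[OF assms(4,2)]) (simp add: inv)
  with bij assms show "diffeomorphism_between S T f"
    by (simp add: diffeomorphism_between_def)
qed

section \<open>Bilinear forms of Lorentzian signature\<close>

lemma form_of_eq:
  "form_of G x a b = (\<Sum>i\<in>UNIV. \<Sum>j\<in>UNIV. a $ i * G x $ i $ j * b $ j)"
  by (simp add: form_of_def inner_vec_def matrix_vector_mult_def sum_distrib_left mult.assoc)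

lemma bilinear_form_of: "bilinear (form_of G x)"
proof -
  have "linear (\<lambda>b. form_of G x a b)" "linear (\<lambda>a. form_of G x a b)" for a b
    unfolding form_of_eq
    by (intro linearI; simp add: distrib_left distrib_right sum.distrib sum_distrib_left mult_ac)+
  then show ?thesis by (simp add: bilinear_def)
qed

lemma form_of_metric_components:
  assumes "bilinear (g x)"
  shows "form_of (metric_components g) x = g x"
proof -
  have "form_of (metric_components g) x (axis i 1) (axis j 1) = g x (axis i 1) (axis j 1)" for i j
    by (simp add: form_of_def metric_components_def matrix_vector_mul_component inner_axis' inner_axis)
  then have "\<forall>i\<in>Basis. \<forall>j\<in>Basis. form_of (metric_components g) x i j = g x i j"
    by (auto simp: Basis_vec_def)
  then show ?thesis
    using bilinear_eq_stdbasis[OF bilinear_form_of assms] by blast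
qed

text \<open>An injective endomorphism is invertible, and the preimage of an orthonormal basis for
  \<open>B\<close> is one for the pulled-back form: signature is invariant under congruence.\<close>

lemma lorentzian_form_comp:
  fixes B :: "'e::euclidean_space \<Rightarrow> 'e \<Rightarrow> real" and T :: "'e \<Rightarrow> 'e"
  assumes B: "lorentzian_form B" and T: "linear T" "inj T"
  shows "lorentzian_form (\<lambda>a b. B (T a) (T b))"
proof -
  from B obtain E e where bil: "bilinear B" and sym: "\<And>x y. B x y = B y x"
    and E: "independent E" "span E = UNIV" "e \<in> E" "B e e = 1"
      "\<forall>x\<in>E - {e}. B x x = -1" "\<forall>x\<in>E. \<forall>y\<in>E. x \<noteq> y \<longrightarrow> B x y = 0"
    unfolding lorentzian_form_def by blast
  obtain S where S: "linear S" "\<And>x. S (T x) = x" "\<And>x. T (S x) = x"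
    using linear_injective_isomorphism[OF T] by auto
  have "inj S" by (metis S(3) injI)
  have "bilinear (\<lambda>a b. B (T a) (T b))"
    using bil linear_compose[OF T(1)] by (auto simp: bilinear_def o_def)
  moreover have "independent (S ` E)"
    using linear_independent_injective_image[OF S(1) E(1)] \<open>inj S\<close> inj_on_subset by blast
  moreover have "span (S ` E) = UNIV"
    using linear_span_image[OF S(1)] E(2) S(2) by (metis surjI)
  moreover have "\<forall>x\<in>S ` E - {S e}. B (T x) (T x) = -1"
    using E(5) by (auto simp: S(3))
  moreover have "\<forall>x\<in>S ` E. \<forall>y\<in>S ` E. x \<noteq> y \<longrightarrow> B (T x) (T y) = 0"
    using E(6) by (auto simp: S(3))
  moreover have "S e \<in> S ` E" "B (T (S e)) (T (S e)) = 1" using E(3,4) S(3) by auto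
  ultimately show ?thesis
    unfolding lorentzian_form_def using sym by blast
qed

lemma lorentzian_form_standard:
  "lorentzian_form (\<lambda>a b :: real ^ 4. a $ 0 * b $ 0 - a $ 1 * b $ 1 - a $ 2 * b $ 2 - a $ 3 * b $ 3)"
proof -
  let ?B = "\<lambda>a b :: real ^ 4. a $ 0 * b $ 0 - a $ 1 * b $ 1 - a $ 2 * b $ 2 - a $ 3 * b $ 3"
  have "bilinear ?B"
    unfolding bilinear_def by (intro conjI allI linearI) (simp_all add: algebra_simps)
  moreover have "\<forall>x\<in>Basis - {axis 0 1}. ?B x x = -1"
  proof
    fix x :: "real ^ 4" assume x: "x \<in> Basis - {axis 0 1}"
    have "\<forall>i. i \<noteq> 0 \<longrightarrow> ?B (axis i 1) (axis i 1) = -1"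
      unfolding forall_4_from_0 by (simp add: axis_def)
    moreover obtain i where "x = axis i 1" "i \<noteq> 0"
      using x by (auto simp: Basis_vec_def)
    ultimately show "?B x x = -1" by blast
  qed
  moreover have "\<forall>x\<in>Basis. \<forall>y\<in>Basis. x \<noteq> y \<longrightarrow> ?B x y = 0"
  proof (intro ballI impI)
    fix x y :: "real ^ 4" assume "x \<in> Basis" "y \<in> Basis" "x \<noteq> y"
    then obtain i j where "x = axis i 1" "y = axis j 1" "i \<noteq> j"
      by (auto simp: Basis_vec_def)
    moreover have "\<forall>i j. i \<noteq> j \<longrightarrow> ?B (axis i 1) (axis j 1) = 0"
      unfolding forall_4_from_0 by (simp add: axis_def)
    ultimately show "?B x y = 0" by blast
  qed
  moreover have "axis 0 1 \<in> (Basis :: (real ^ 4) set)" "?B (axis 0 1) (axis 0 1) = 1"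
    by (auto simp: Basis_vec_def axis_def)
  moreover have "\<forall>x y. ?B x y = ?B y x" by (simp add: mult.commute)
  ultimately show ?thesis
    unfolding lorentzian_form_def using independent_Basis span_Basis by blast
qed

text \<open>\<open>T\<close> exhibits the congruence with the standard form. The null pair is
  diagonalised by \<open>2 x y = ((x + y)\<^sup>2 - (x - y)\<^sup>2) / 2\<close>, whence
  \<open>s = sqrt 2\<close>. Completing the square in the other block gives \<open>k\<close>, the
  shift \<open>q / k\<close> and the remainder \<open>m\<close>, which is positive because
  \<open>p\<close> is negative and the determinant positive.\<close>

lemma lorentzian_form_null_frame:
  fixes p q r :: real
  assumes "p < 0" "p * r - q\<^sup>2 > 0"
  shows "lorentzian_form (\<lambda>a b :: real ^ 4. a $ 0 * b $ 1 + a $ 1 * b $ 0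
    + (p * a $ 2 * b $ 2 + q * (a $ 2 * b $ 3 + a $ 3 * b $ 2) + r * a $ 3 * b $ 3))"
proof -
  define s where "s = sqrt 2"
  define k where "k = sqrt (- p)"
  define m where "m = (p * r - q\<^sup>2) / - p"
  define d where "d = sqrt m"
  have s: "s \<noteq> 0" "s * s = 2" by (auto simp: s_def)
  have k: "k \<noteq> 0" "k * k = - p" using assms(1) by (auto simp: k_def)
  have "m > 0" unfolding m_def using assms by (intro divide_pos_pos) auto
  then have d: "d \<noteq> 0" "d * d = m" by (auto simp: d_def)
  define T :: "real ^ 4 \<Rightarrow> real ^ 4" where "T = (\<lambda>a. vec4 ((a $ 0 + a $ 1) / s) ((a $ 0 - a $ 1) / s)
    (k * a $ 2 - q / k * a $ 3) (d * a $ 3))"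
  have "linear T"
    by (intro linearI) (simp_all add: T_def vec4_eq_iff algebra_simps add_divide_distrib diff_divide_distrib)
  moreover have "a = 0" if "T a = 0" for a
    using that s(1) k(1) d(1) by (auto simp: T_def vec4_eq_iff)
  ultimately have "linear T" "inj T"
    using linear_injective_0 by blast+
  then have *: "lorentzian_form (\<lambda>a b. T a $ 0 * T b $ 0 - T a $ 1 * T b $ 1 - T a $ 2 * T b $ 2
      - T a $ 3 * T b $ 3)"
    by (rule lorentzian_form_comp[OF lorentzian_form_standard])
  have "T a $ 0 * T b $ 0 - T a $ 1 * T b $ 1 - T a $ 2 * T b $ 2 - T a $ 3 * T b $ 3
    = a $ 0 * b $ 1 + a $ 1 * b $ 0
      + (p * a $ 2 * b $ 2 + q * (a $ 2 * b $ 3 + a $ 3 * b $ 2) + r * a $ 3 * b $ 3)" for a b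
  proof -
    have "T a $ 0 * T b $ 0 - T a $ 1 * T b $ 1 = (2 * (a $ 0 * b $ 1 + a $ 1 * b $ 0)) / (s * s)"
      using s(1) by (simp add: T_def field_simps)
    moreover have "T a $ 2 * T b $ 2 = (k * k) * a $ 2 * b $ 2 - q * (a $ 2 * b $ 3 + a $ 3 * b $ 2)
        + q\<^sup>2 / (k * k) * a $ 3 * b $ 3"
      using k(1) by (simp add: T_def field_simps power2_eq_square)
    moreover have "T a $ 3 * T b $ 3 = (d * d) * a $ 3 * b $ 3"
      by (simp add: T_def)
    moreover have "q\<^sup>2 / - p + m = - r"
      using assms(1) by (simp add: m_def field_simps)
    then have "q\<^sup>2 / - p * a $ 3 * b $ 3 + m * a $ 3 * b $ 3 = - r * a $ 3 * b $ 3"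
      by (metis distrib_right)
    ultimately show ?thesis unfolding s(2) k(2) d(2) by (simp add: algebra_simps)
  qed
  with * show ?thesis by simp
qed

text \<open>The inverse of \<open>scaling \<Omega>\<close> for nonzero \<Omega>, in closed form and
  linear; it is also the point at which \<open>rescaled_metric\<close> evaluates the
  components.\<close>

definition unscaling :: "real \<Rightarrow> real ^ 4 \<Rightarrow> real ^ 4" where
  "unscaling \<Omega> y = vec4 (y $ 0) (\<Omega>\<^sup>2 * y $ 1) (\<Omega> * y $ 2) (\<Omega> * y $ 3)"

lemma linear_scaling: "linear (scaling \<Omega>)"
  by (intro linearI) (simp_all add: scaling_def vec4_eq_iff add_divide_distrib)

lemma linear_unscaling: "linear (unscaling \<Omega>)"
  by (intro linearI) (simp_all add: unscaling_def vec4_eq_iff algebra_simps)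

lemma scaling_unscaling [simp]: "\<Omega> \<noteq> 0 \<Longrightarrow> scaling \<Omega> (unscaling \<Omega> y) = y"
  and unscaling_scaling [simp]: "\<Omega> \<noteq> 0 \<Longrightarrow> unscaling \<Omega> (scaling \<Omega> y) = y"
  by (simp_all add: scaling_def unscaling_def vec4_eq_iff)

text \<open>What parts (i) to (iii) use of g_N, stated for a matrix function on an open set of
  \<open>real ^ 4\<close>; inside the locale no manifold occurs.\<close>

locale lightlike_components =
  fixes C :: "(real ^ 4) set" and G :: "real ^ 4 \<Rightarrow> real ^ 4 ^ 4"
  assumes open_C: "open C" and smooth_G: "smooth_on C G"
    and lorentzian: "x \<in> C \<Longrightarrow> lorentzian_form (form_of G x)"
    and G_shape: "x \<in> C \<Longrightarrow> G x = vec4 (vec4 0 1 0 0)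
      (vec4 1 (G x $ 1 $ 1) (G x $ 1 $ 2) (G x $ 1 $ 3))
      (vec4 0 (G x $ 2 $ 1) (G x $ 2 $ 2) (G x $ 2 $ 3))
      (vec4 0 (G x $ 3 $ 1) (G x $ 3 $ 2) (G x $ 3 $ 3))"
    and negative: "x \<in> C \<Longrightarrow> \<xi> 2 \<noteq> 0 \<or> \<xi> 3 \<noteq> 0 \<Longrightarrow>
      (\<Sum>i\<in>{2,3}. \<Sum>j\<in>{2,3}. G x $ i $ j * \<xi> i * \<xi> j) < 0"
begin

lemma G_lightlike_entries:
  assumes "x \<in> C"
  shows "G x $ 0 $ 0 = 0" "G x $ 0 $ 1 = 1" "G x $ 0 $ 2 = 0" "G x $ 0 $ 3 = 0"
    "G x $ 1 $ 0 = 1" "G x $ 2 $ 0 = 0" "G x $ 3 $ 0 = 0"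
  by (subst G_shape[OF assms], simp)+

lemma G_symmetric: assumes "x \<in> C" shows "G x $ i $ j = G x $ j $ i"
proof -
  have "form_of G x (axis i 1) (axis j 1) = G x $ i $ j" for i j
    by (simp add: form_of_def matrix_vector_mul_component inner_axis' inner_axis)
  moreover have "form_of G x a b = form_of G x b a" for a b
    using lorentzian[OF assms] unfolding lorentzian_form_def by blast
  ultimately show ?thesis by metis
qed

lemma transverse_negative:
  assumes "x \<in> C"
  shows "G x $ 2 $ 2 < 0" "G x $ 2 $ 2 * G x $ 3 $ 3 - (G x $ 2 $ 3)\<^sup>2 > 0"
proof -
  show neg: "G x $ 2 $ 2 < 0"
    using negative[OF assms, of "\<lambda>i. if i = 2 then 1 else 0"] by simp
  \<comment> \<open>For a symmetric block with entries p, q, r the vector (-q, p) is orthogonal to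
    the first basis vector and has square norm p (p r - q^2). As p < 0, negativity of this norm
    gives the sign of the determinant.\<close>
  let ?\<xi> = "\<lambda>i::4. if i = 2 then - G x $ 2 $ 3 else G x $ 2 $ 2"
  have "(\<Sum>i\<in>{2,3}. \<Sum>j\<in>{2,3}. G x $ i $ j * ?\<xi> i * ?\<xi> j)
      = G x $ 2 $ 2 * (G x $ 2 $ 2 * G x $ 3 $ 3 - (G x $ 2 $ 3)\<^sup>2)"
    using G_symmetric[OF assms, of 3 2] by (simp add: algebra_simps power2_eq_square)
  then have "G x $ 2 $ 2 * (G x $ 2 $ 2 * G x $ 3 $ 3 - (G x $ 2 $ 3)\<^sup>2) < 0"
    using negative[OF assms, of ?\<xi>] neg by simp
  then show "G x $ 2 $ 2 * G x $ 3 $ 3 - (G x $ 2 $ 3)\<^sup>2 > 0"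
    using neg by (simp add: mult_less_0_iff)
qed

lemma smooth_on_entry:
  fixes f :: "'e::euclidean_space \<Rightarrow> real ^ 4"
  assumes "open S" "smooth_on S f" "f ` S \<subseteq> C"
  shows "smooth_on S (\<lambda>x. G (f x) $ i $ j)"
  by (intro smooth_on_vec_nth[OF assms(1)] smooth_on_compose[OF assms(1) open_C assms(2) smooth_G assms(3)])

lemma scaling_image: "\<Omega> \<noteq> 0 \<Longrightarrow> scaling \<Omega> ` C = unscaling \<Omega> -` C"
  by (auto intro: image_eqI[of _ _ "unscaling \<Omega> _"])

lemma open_scaling_image:
  assumes "\<Omega> \<noteq> 0" shows "open (scaling \<Omega> ` C)"
  unfolding scaling_image[OF assms]
  using linear_conv_bounded_linear linear_unscaling
  by (intro open_vimage open_C linear_continuous_on) blast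

lemma
  assumes "\<Omega> \<noteq> 0"
  shows diffeomorphism_scaling: "diffeomorphism_between C (scaling \<Omega> ` C) (scaling \<Omega>)"
    and inv_into_scaling: "y \<in> scaling \<Omega> ` C \<Longrightarrow> inv_into C (scaling \<Omega>) y = unscaling \<Omega> y"
proof -
  have "smooth_on C (scaling \<Omega>)" "smooth_on (scaling \<Omega> ` C) (unscaling \<Omega>)"
    by (intro smooth_on_linear linear_scaling linear_unscaling open_C open_scaling_image[OF assms])+
  note * = diffeomorphism_betweenI[OF open_C open_scaling_image[OF assms] this]
  show "diffeomorphism_between C (scaling \<Omega> ` C) (scaling \<Omega>)"
    by (rule *) (use assms in auto)
  show "inv_into C (scaling \<Omega>) y = unscaling \<Omega> y" if "y \<in> scaling \<Omega> ` C"
    by (rule *(2)[OF _ _ _ _ that]) (use assms in auto)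
qed

text \<open>\<open>unscaling \<Omega>\<close> gives the coordinates the weights 0, 2, 1, 1, so after
  division by \<Omega>^2 an entry carries \<Omega> to the sum of its two weights minus 2. The power
  is negative exactly for the entries (0,0), (0,2), (0,3) and their transposes, which vanish in
  lightlike coordinates.\<close>

lemma form_of_rescaled_metric:
  assumes "\<Omega> \<noteq> 0" "unscaling \<Omega> y \<in> C"
  shows "\<Omega>\<^sup>2 * form_of (rescaled_metric G \<Omega>) y a b
    = form_of G (unscaling \<Omega> y) (unscaling \<Omega> a) (unscaling \<Omega> b)"
proof -
  have "rescaled_metric G \<Omega> y = (let g = G (unscaling \<Omega> y) in
     vec4 (vec4 0            1                0              0)
          (vec4 1 (\<Omega>\<^sup>2 * g $ 1 $ 1) (\<Omega> * g $ 1 $ 2) (\<Omega> * g $ 1 $ 3))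
          (vec4 0 (\<Omega> * g $ 2 $ 1)    (g $ 2 $ 2)      (g $ 2 $ 3))
          (vec4 0 (\<Omega> * g $ 3 $ 1)    (g $ 3 $ 2)      (g $ 3 $ 3)))"
    by (simp add: rescaled_metric_def unscaling_def)
  then show ?thesis
    unfolding form_of_eq sum_UNIV_4_from_0 Let_def
    by (simp add: G_lightlike_entries[OF assms(2)] unscaling_def[of _ a] unscaling_def[of _ b]
        algebra_simps power2_eq_square)
qed

lemma lorentzian_metric_on_rescaled:
  assumes "\<Omega> \<noteq> 0"
  shows "lorentzian_metric_on (scaling \<Omega> ` C) (rescaled_metric G \<Omega>)"
  unfolding lorentzian_metric_on_def
proof (intro conjI ballI)
  let ?S = "scaling \<Omega> ` C"
  show S: "open ?S" by (rule open_scaling_image[OF assms])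
  have "smooth_on ?S (\<lambda>y. G (unscaling \<Omega> y) $ i $ j)" for i j
    by (rule smooth_on_entry[OF S smooth_on_linear[OF S linear_unscaling]])
      (simp add: scaling_image[OF assms] image_subset_iff)
  then show "smooth_on ?S (rescaled_metric G \<Omega>)"
    unfolding rescaled_metric_def[abs_def] Let_def unscaling_def
    by (intro smooth_on_vec4[OF S] smooth_on_mult[OF S] smooth_on_const)
  fix y assume y: "y \<in> ?S"
  then have "unscaling \<Omega> y \<in> C" using scaling_image[OF assms] by blast
  note form = form_of_rescaled_metric[OF assms this] and lor = lorentzian[OF this]
  \<comment> \<open>The factor \<Omega>^2 is split evenly between the two arguments, so the rescaled
    form is congruent to a form of known signature.\<close>
  let ?T = "\<lambda>a. (1 / \<Omega>) *\<^sub>R unscaling \<Omega> a"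
  have "linear ?T" by (rule linear_compose_scale_right[OF linear_unscaling])
  moreover have "inj ?T"
    using assms by (intro inj_on_inverseI[of _ "\<lambda>a. scaling \<Omega> (\<Omega> *\<^sub>R a)"]) simp
  ultimately have "lorentzian_form (\<lambda>a b. form_of G (unscaling \<Omega> y) (?T a) (?T b))"
    by (rule lorentzian_form_comp[OF lor])
  moreover have "form_of G (unscaling \<Omega> y) (?T a) (?T b) = form_of (rescaled_metric G \<Omega>) y a b" for a b
    using form[of a b] assms
    by (simp add: bilinear_lmul[OF bilinear_form_of] bilinear_rmul[OF bilinear_form_of]
        field_simps power2_eq_square)
  ultimately show "lorentzian_form (form_of (rescaled_metric G \<Omega>) y)"
    by simp
qed

text \<open>On the image of \<open>C\<close> the inverse is linear, hence its own derivative, and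
  the pullback reduces to the algebra of \<open>form_of_rescaled_metric\<close>.\<close>

lemma pullback_inv_scaling:
  assumes "\<Omega> \<noteq> 0" "y \<in> scaling \<Omega> ` C"
  shows "pullback (inv_into C (scaling \<Omega>)) (form_of G) y a b
    = \<Omega>\<^sup>2 * form_of (rescaled_metric G \<Omega>) y a b"
proof -
  have "(unscaling \<Omega> has_derivative unscaling \<Omega>) (at y)"
    using linear_unscaling linear_conv_bounded_linear bounded_linear_imp_has_derivative by blast
  then have "(inv_into C (scaling \<Omega>) has_derivative unscaling \<Omega>) (at y)"
    by (rule has_derivative_transform_within_open[OF _ open_scaling_image[OF assms(1)] assms(2)])
      (simp add: inv_into_scaling[OF assms(1)])
  then have "frechet_derivative (inv_into C (scaling \<Omega>)) (at y) = unscaling \<Omega>"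
    by (rule frechet_derivative_at[symmetric])
  moreover have "unscaling \<Omega> y \<in> C" using assms(2) scaling_image[OF assms(1)] by blast
  ultimately show ?thesis
    by (simp add: pullback_def inv_into_scaling[OF assms] form_of_rescaled_metric[OF assms(1)])
qed

section \<open>The limit metric along the x^0 axis\<close>

lemma linear_ray: "linear (\<lambda>y :: real ^ 4. vec4 (y $ 0) 0 0 (0::real))"
  by (intro linearI) (simp_all add: vec4_eq_iff)

lemma form_of_limit_metric:
  assumes "vec4 (y $ 0) 0 0 0 \<in> C"
  defines "g \<equiv> G (vec4 (y $ 0) 0 0 0)"
  shows "form_of (limit_metric G) y a b = a $ 0 * b $ 1 + a $ 1 * b $ 0
    + (g $ 2 $ 2 * a $ 2 * b $ 2 + g $ 2 $ 3 * (a $ 2 * b $ 3 + a $ 3 * b $ 2) + g $ 3 $ 3 * a $ 3 * b $ 3)"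
  unfolding form_of_eq sum_UNIV_4_from_0 limit_metric_def Let_def g_def
  using G_symmetric[OF assms(1), of 3 2] by (simp add: algebra_simps)

lemma lorentzian_metric_on_limit:
  "lorentzian_metric_on {y. vec4 (y $ 0) 0 0 0 \<in> C} (limit_metric G)"
  unfolding lorentzian_metric_on_def
proof (intro conjI ballI)
  let ?S = "{y :: real ^ 4. vec4 (y $ 0) 0 0 0 \<in> C}"
  have "open ((\<lambda>y :: real ^ 4. vec4 (y $ 0) 0 0 0) -` C)"
    using linear_conv_bounded_linear linear_ray
    by (intro open_vimage open_C linear_continuous_on) blast
  then show S: "open ?S" by (simp add: vimage_def)
  have "smooth_on ?S (\<lambda>y. G (vec4 (y $ 0) 0 0 0) $ i $ j)" for i j
    by (rule smooth_on_entry[OF S smooth_on_linear[OF S linear_ray]]) auto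
  then show "smooth_on ?S (limit_metric G)"
    unfolding limit_metric_def[abs_def] Let_def
    by (intro smooth_on_vec4[OF S] smooth_on_const)
  fix y assume "y \<in> ?S"
  then have y: "vec4 (y $ 0) 0 0 0 \<in> C" by simp
  show "lorentzian_form (form_of (limit_metric G) y)"
    using lorentzian_form_null_frame[OF transverse_negative[OF y]]
    by (simp add: form_of_limit_metric[OF y, abs_def])
qed

text \<open>The points \<open>unscaling \<Omega> y\<close> tend to the axis point
  \<open>vec4 (y $ 0) 0 0 0\<close>. Openness of \<open>C\<close> there puts \<open>y\<close> into
  the domain of the rescaled metric for all small \<Omega>, although that domain varies. Continuity
  of \<open>G\<close> gives the transverse entries, and the factors \<Omega> and \<Omega>^2 remove
  the others.\<close>

lemma
  assumes "vec4 (y $ 0) 0 0 0 \<in> C"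
  shows eventually_in_scaling_image: "\<forall>\<^sub>F \<Omega> in at_right 0. y \<in> scaling \<Omega> ` C"
    and rescaled_metric_tendsto: "((\<lambda>\<Omega>. rescaled_metric G \<Omega> y $ i $ j)
      \<longlongrightarrow> limit_metric G y $ i $ j) (at_right 0)"
proof -
  have id: "((\<lambda>\<Omega>. \<Omega>) \<longlongrightarrow> (0::real)) (at_right 0)" by (rule tendsto_ident_at)
  have sq: "((\<lambda>\<Omega>. \<Omega>\<^sup>2) \<longlongrightarrow> (0::real)) (at_right 0)"
    using tendsto_power[OF id, of 2] by simp
  have "\<forall>i. ((\<lambda>\<Omega>. unscaling \<Omega> y $ i) \<longlongrightarrow> vec4 (y $ 0) 0 0 0 $ i) (at_right 0)"
    unfolding forall_4_from_0
    using tendsto_mult_left_zero[OF id] tendsto_mult_left_zero[OF sq] by (simp add: unscaling_def)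
  then have lim: "((\<lambda>\<Omega>. unscaling \<Omega> y) \<longlongrightarrow> vec4 (y $ 0) 0 0 0) (at_right 0)"
    by (intro vec_tendstoI) blast
  have "\<forall>\<^sub>F \<Omega> in at_right 0. unscaling \<Omega> y \<in> C"
    by (rule topological_tendstoD[OF lim open_C assms])
  moreover have "\<forall>\<^sub>F \<Omega> in at_right 0. \<Omega> \<noteq> (0::real)"
    by (auto simp: eventually_at_filter)
  ultimately show "\<forall>\<^sub>F \<Omega> in at_right 0. y \<in> scaling \<Omega> ` C"
    by eventually_elim (auto simp: scaling_image)
  have "isCont G (vec4 (y $ 0) 0 0 0)"
    using smooth_on_imp_continuous_on[OF smooth_G] open_C assms
    by (simp add: continuous_on_eq_continuous_at)
  from isCont_tendsto_compose[OF this lim]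
  have G: "((\<lambda>\<Omega>. G (unscaling \<Omega> y) $ i $ j) \<longlongrightarrow> G (vec4 (y $ 0) 0 0 0) $ i $ j) (at_right 0)" for i j
    by (intro tendsto_vec_nth)
  have "\<forall>i j. ((\<lambda>\<Omega>. rescaled_metric G \<Omega> y $ i $ j) \<longlongrightarrow> limit_metric G y $ i $ j) (at_right 0)"
    unfolding forall_4_from_0
    using G tendsto_mult[OF id G] tendsto_mult[OF sq G]
    by (simp add: rescaled_metric_def limit_metric_def unscaling_def Let_def)
  then show "((\<lambda>\<Omega>. rescaled_metric G \<Omega> y $ i $ j) \<longlongrightarrow> limit_metric G y $ i $ j) (at_right 0)"
    by blast
qed

end


section \<open>Smooth frames in normal gauge\<close>

text \<open>The antiderivative is taken on a compact interval inside the domain, which is why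
  \<epsilon> must be less than \<delta>. Smoothness is inherited from \<open>f\<close>: order k + 1
  of \<open>g\<close> is order k of \<open>f\<close>.\<close>

lemma smooth_antiderivative:
  fixes f :: "real \<Rightarrow> real"
  assumes "smooth_on {-\<delta><..<\<delta>} f" "\<epsilon> < \<delta>"
  obtains g where "smooth_on {-\<epsilon><..<\<epsilon>} g"
    "\<And>t. t \<in> {-\<epsilon><..<\<epsilon>} \<Longrightarrow> (g has_real_derivative f t) (at t)"
proof -
  have f: "smooth_on {-\<epsilon><..<\<epsilon>} f"
    by (rule smooth_on_subset[OF assms(1)]) (use assms(2) in auto)
  have "continuous_on {-\<epsilon>..\<epsilon>} f"
    by (rule continuous_on_subset[OF smooth_on_imp_continuous_on[OF assms(1)]]) (use assms(2) in auto)
  then obtain g where g: "\<And>t. t \<in> {-\<epsilon>..\<epsilon>} \<Longrightarrow> (g has_vector_derivative f t) (at t within {-\<epsilon>..\<epsilon>})"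
    by (rule antiderivative_continuous) (rule that, blast)
  have deriv: "(g has_real_derivative f t) (at t)" if t: "t \<in> {-\<epsilon><..<\<epsilon>}" for t
  proof -
    have t': "t \<in> {-\<epsilon>..\<epsilon>}" and sub: "{-\<epsilon><..<\<epsilon>} \<subseteq> {-\<epsilon>..\<epsilon>}" using t by auto
    have "(g has_real_derivative f t) (at t within {-\<epsilon><..<\<epsilon>})"
      unfolding has_real_derivative_iff_has_vector_derivative
      by (rule has_vector_derivative_within_subset[OF g[OF t'] sub])
    then show ?thesis
      by (simp only: at_within_open[OF t open_greaterThanLessThan])
  qed
  have Suc: "Ck_on (Suc k) {-\<epsilon><..<\<epsilon>} g" for k
  proof (rule Ck_on_SucI[where f' = "\<lambda>t v. v *\<^sub>R f t"])
    show "(g has_derivative (\<lambda>v. v *\<^sub>R f t)) (at t)" if "t \<in> {-\<epsilon><..<\<epsilon>}" for t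
      using deriv[OF that] by (simp add: has_field_derivative_def mult_commute_abs)
    show "Ck_on k {-\<epsilon><..<\<epsilon>} (\<lambda>t. v *\<^sub>R f t)" for v
      by (intro Ck_on_scaleR Ck_on_const) (use f smooth_on_def in auto)
  qed simp
  have "smooth_on {-\<epsilon><..<\<epsilon>} g"
    unfolding smooth_on_def using Suc Ck_on_SucD by blast
  with deriv that show ?thesis by blast
qed

text \<open>The form of a symmetric two by two matrix with entries \<open>p\<close>,
  \<open>q\<close>, \<open>r\<close>, written out in scalars so that the frame computations become
  polynomial identities.\<close>

definition bil2 :: "real \<Rightarrow> real \<Rightarrow> real \<Rightarrow> real \<Rightarrow> real \<Rightarrow> real \<Rightarrow> real \<Rightarrow> real" where
  "bil2 p q r x2 x3 y2 y3 = p * x2 * y2 + q * (x2 * y3 + x3 * y2) + r * x3 * y3"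

text \<open>With \<open>x\<close>, \<open>y\<close> the derivatives of the frame vectors
  \<open>a\<close>, \<open>b\<close>, this is the antisymmetric part of a two by two matrix of
  pairings. Transforming both pairs by the same matrix multiplies that part by its determinant, here
  c^2 + s^2.\<close>

lemma bil2_rotation:
  "bil2 p q r (c * x2 + s * y2) (c * x3 + s * y3) (c * b2 - s * a2) (c * b3 - s * a3)
    - bil2 p q r (c * a2 + s * b2) (c * a3 + s * b3) (c * y2 - s * x2) (c * y3 - s * x3)
    = (c * c + s * s) * (bil2 p q r x2 x3 b2 b3 - bil2 p q r a2 a3 y2 y3)"
  unfolding bil2_def by (simp add: algebra_simps)

text \<open>Gram-Schmidt applied to the coordinate frame.\<close>

lemma smooth_orthonormal_frame:
  fixes p q r :: "real \<Rightarrow> real"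
  assumes S: "open S" and smooth: "smooth_on S p" "smooth_on S q" "smooth_on S r"
    and neg: "\<And>t. t \<in> S \<Longrightarrow> p t < 0" "\<And>t. t \<in> S \<Longrightarrow> p t * r t - (q t)\<^sup>2 > 0"
  obtains a b :: "4 \<Rightarrow> real \<Rightarrow> real" where
    "\<And>i. smooth_on S (a i)" "\<And>i. smooth_on S (b i)"
    "\<And>t. t \<in> S \<Longrightarrow> bil2 (p t) (q t) (r t) (a 2 t) (a 3 t) (a 2 t) (a 3 t) = -1"
    "\<And>t. t \<in> S \<Longrightarrow> bil2 (p t) (q t) (r t) (a 2 t) (a 3 t) (b 2 t) (b 3 t) = 0"
    "\<And>t. t \<in> S \<Longrightarrow> bil2 (p t) (q t) (r t) (b 2 t) (b 3 t) (b 2 t) (b 3 t) = -1"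
proof -
  define w where "w = (\<lambda>t. (- p t) powr (1/2))"
  define w' where "w' = (\<lambda>t. (- p t) powr (-1/2))"
  define e where "e = (\<lambda>t. (p t * r t - q t * q t) powr (-1/2))"
  have p_smooth: "smooth_on S (\<lambda>t. - p t)" "(\<lambda>t. - p t) ` S \<subseteq> {0<..}"
    using smooth_on_minus[OF S smooth(1)] neg(1) by auto
  have d_smooth: "smooth_on S (\<lambda>t. p t * r t - q t * q t)" "(\<lambda>t. p t * r t - q t * q t) ` S \<subseteq> {0<..}"
    using neg(2) by (auto intro!: smooth_on_diff smooth_on_mult S smooth simp: power2_eq_square)
  have w: "smooth_on S w" and w': "smooth_on S w'"
    unfolding w_def w'_def
    by (rule smooth_on_compose[OF S open_greaterThan p_smooth(1) smooth_on_powr p_smooth(2)])+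
  have e: "smooth_on S e"
    unfolding e_def
    by (rule smooth_on_compose[OF S open_greaterThan d_smooth(1) smooth_on_powr d_smooth(2)])
  define a :: "4 \<Rightarrow> real \<Rightarrow> real" where "a = (\<lambda>i. if i = 2 then w' else (\<lambda>t. 0))"
  \<comment> \<open>On \<open>S\<close> this is \<open>(q, - p)\<close> scaled by
    \<open>w' * e\<close>: it is orthogonal to the first coordinate vector, and its square norm
    before scaling is \<open>p\<close> times the determinant.\<close>
  define b :: "4 \<Rightarrow> real \<Rightarrow> real" where
    "b = (\<lambda>i. if i = 2 then (\<lambda>t. q t * w' t * e t) else (\<lambda>t. w t * e t))"
  have rel: "p t = - (w t * w t)" "w t * w' t = 1" "e t * e t * (p t * r t - q t * q t) = 1" if "t \<in> S" for t
    using neg[OF that] by (simp_all add: w_def w'_def e_def power2_eq_square powr_minus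
        field_simps flip: powr_add)
  have "smooth_on S (a i)" for i using w' by (simp add: a_def smooth_on_const)
  moreover have "smooth_on S (b i)" for i
    by (simp add: b_def smooth_on_mult S smooth w w' e)
  moreover have "bil2 (p t) (q t) (r t) (a 2 t) (a 3 t) (a 2 t) (a 3 t) = -1" if "t \<in> S" for t
  proof -
    have "p t * w' t * w' t = - (w t * w' t) * (w t * w' t)" using rel(1)[OF that] by simp
    then show ?thesis using rel(2)[OF that] by (simp add: bil2_def a_def)
  qed
  moreover have "bil2 (p t) (q t) (r t) (a 2 t) (a 3 t) (b 2 t) (b 3 t) = 0" if "t \<in> S" for t
  proof -
    have "bil2 (p t) (q t) (r t) (a 2 t) (a 3 t) (b 2 t) (b 3 t)
        = w' t * q t * e t * w t * (1 - w t * w' t)"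
      using rel(1,2)[OF that] by (simp add: bil2_def a_def b_def algebra_simps)
    then show ?thesis using rel(2)[OF that] by simp
  qed
  moreover have "bil2 (p t) (q t) (r t) (b 2 t) (b 3 t) (b 2 t) (b 3 t) = -1" if "t \<in> S" for t
  proof -
    have "bil2 (p t) (q t) (r t) (b 2 t) (b 3 t) (b 2 t) (b 3 t)
        = e t * e t * (- q t * q t * (w t * w' t) * (w t * w' t) + 2 * q t * q t * (w t * w' t)
          + r t * (w t * w t))"
      using rel(1)[OF that] by (simp add: bil2_def b_def algebra_simps)
    also have "\<dots> = - (e t * e t * (p t * r t - q t * q t))"
      using rel(1,2)[OF that] by (simp add: algebra_simps)
    finally show ?thesis using rel(3)[OF that] by simp
  qed
  ultimately show ?thesis by (rule that)
qed

text \<open>Rotating an orthonormal frame by an angle \<open>\<theta>\<close> changes the difference of the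
  \<open>(2,3)\<close> and \<open>(3,2)\<close> entries of \<open>h\<^sub>i\<^sub>j \<partial>\<^sub>uM\<^sup>i\<^sub>k M\<^sup>j\<^sub>l\<close> by \<open>-2 \<theta>'\<close>, so that \<open>\<theta>\<close> can be found by integration.\<close>

lemma parallel_frame_exists:
  fixes h :: "4 \<Rightarrow> 4 \<Rightarrow> real \<Rightarrow> real"
  assumes "\<epsilon> < \<delta>"
    and smooth: "\<And>i j. smooth_on {-\<delta><..<\<delta>} (h i j)"
    and sym: "\<And>t. t \<in> {-\<delta><..<\<delta>} \<Longrightarrow> h 3 2 t = h 2 3 t"
    and neg: "\<And>t. t \<in> {-\<delta><..<\<delta>} \<Longrightarrow> h 2 2 t < 0"
      "\<And>t. t \<in> {-\<delta><..<\<delta>} \<Longrightarrow> h 2 2 t * h 3 3 t - (h 2 3 t)\<^sup>2 > 0"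
  shows "\<exists>M :: 4 \<Rightarrow> 4 \<Rightarrow> real \<Rightarrow> real. (\<forall>i\<in>{2,3}. \<forall>j\<in>{2,3}. smooth_on {-\<epsilon><..<\<epsilon>} (M i j)) \<and>
    (\<forall>t. \<bar>t\<bar> < \<epsilon> \<longrightarrow> (\<forall>k\<in>{2,3}. \<forall>l\<in>{2,3}.
      (\<Sum>i\<in>{2,3}. \<Sum>j\<in>{2,3}. h i j t * M i k t * M j l t) = (if k = l then -1 else 0) \<and>
      (\<Sum>i\<in>{2,3}. \<Sum>j\<in>{2,3}. h i j t * deriv (M i k) t * M j l t)
        = (\<Sum>i\<in>{2,3}. \<Sum>j\<in>{2,3}. h i j t * M i k t * deriv (M j l) t)))"
proof -
  let ?J = "{-\<delta><..<\<delta>}" and ?I = "{-\<epsilon><..<\<epsilon>}"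
  let ?B = "\<lambda>t. bil2 (h 2 2 t) (h 2 3 t) (h 3 3 t)"
  have J: "open ?J" and I: "open ?I" by auto
  obtain a b :: "4 \<Rightarrow> real \<Rightarrow> real" where ab: "\<And>i. smooth_on ?J (a i)" "\<And>i. smooth_on ?J (b i)"
    and orth: "\<And>t. t \<in> ?J \<Longrightarrow> ?B t (a 2 t) (a 3 t) (a 2 t) (a 3 t) = -1"
      "\<And>t. t \<in> ?J \<Longrightarrow> ?B t (a 2 t) (a 3 t) (b 2 t) (b 3 t) = 0"
      "\<And>t. t \<in> ?J \<Longrightarrow> ?B t (b 2 t) (b 3 t) (b 2 t) (b 3 t) = -1"
    using smooth_orthonormal_frame[OF J smooth smooth smooth neg] by metis
  \<comment> \<open>Half the antisymmetric part for the unrotated frame, so that the rotation with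
    \<theta>' = \<kappa> cancels it.\<close>
  define \<kappa> where "\<kappa> = (\<lambda>t. 1/2 * (?B t (deriv (a 2) t) (deriv (a 3) t) (b 2 t) (b 3 t)
    - ?B t (a 2 t) (a 3 t) (deriv (b 2) t) (deriv (b 3) t)))"
  have "smooth_on ?J \<kappa>"
    unfolding \<kappa>_def bil2_def
    by (intro smooth_on_mult smooth_on_add smooth_on_diff smooth_on_const smooth_on_deriv J smooth ab)
  then obtain \<theta> where \<theta>: "smooth_on ?I \<theta>"
    and d\<theta>: "\<And>t. t \<in> ?I \<Longrightarrow> (\<theta> has_real_derivative \<kappa> t) (at t)"
    using smooth_antiderivative[OF _ assms(1)] by blast
  define M :: "4 \<Rightarrow> 4 \<Rightarrow> real \<Rightarrow> real" where
    "M = (\<lambda>i k. if k = 2 then (\<lambda>t. cos (\<theta> t) * a i t + sin (\<theta> t) * b i t)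
      else (\<lambda>t. cos (\<theta> t) * b i t - sin (\<theta> t) * a i t))"
  have "?I \<subseteq> ?J" using assms(1) by auto
  then have ab': "smooth_on ?I (a i)" "smooth_on ?I (b i)" for i
    using ab smooth_on_subset by blast+
  have sc: "smooth_on ?I (\<lambda>t. sin (\<theta> t))" "smooth_on ?I (\<lambda>t. cos (\<theta> t))"
    using smooth_on_compose[OF I open_UNIV \<theta>] smooth_on_sin_cos by auto
  have M_smooth: "smooth_on ?I (M i k)" for i k
    unfolding M_def by (auto intro!: smooth_on_mult smooth_on_add smooth_on_diff I sc ab')
  have main: "(\<Sum>i\<in>{2,3}. \<Sum>j\<in>{2,3}. h i j t * M i k t * M j l t) = (if k = l then -1 else 0) \<and>
      (\<Sum>i\<in>{2,3}. \<Sum>j\<in>{2,3}. h i j t * deriv (M i k) t * M j l t)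
        = (\<Sum>i\<in>{2,3}. \<Sum>j\<in>{2,3}. h i j t * M i k t * deriv (M j l) t)"
    if t: "\<bar>t\<bar> < \<epsilon>" and kl: "k \<in> {2,3}" "l \<in> {2,3}" for t k l
  proof -
    have tI: "t \<in> ?I" and tJ: "t \<in> ?J" using t assms(1) by auto
    have sum_B: "(\<Sum>i\<in>{2,3}. \<Sum>j\<in>{2,3}. h i j t * x i * y j) = ?B t (x 2) (x 3) (y 2) (y 3)"
      for x y :: "4 \<Rightarrow> real"
      by (simp add: bil2_def sym[OF tJ] algebra_simps)
    let ?c = "cos (\<theta> t)" and ?s = "sin (\<theta> t)"
    have cs: "?c * ?c + ?s * ?s = 1"
      using sin_cos_squared_add2[of "\<theta> t"] by (simp add: power2_eq_square)
    have da: "(a i has_real_derivative deriv (a i) t) (at t)" for i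
      by (rule smooth_on_DERIV[OF ab'(1) tI])
    have db: "(b i has_real_derivative deriv (b i) t) (at t)" for i
      by (rule smooth_on_DERIV[OF ab'(2) tI])
    have M: "M i 2 t = ?c * a i t + ?s * b i t" "M i 3 t = ?c * b i t - ?s * a i t" for i
      by (simp_all add: M_def)
    \<comment> \<open>Differentiating a rotation turns it by a further right angle, so \<theta>'
      contributes a multiple of the other column: +\<kappa> times column 3 here, -\<kappa> times
      column 2 in \<open>dM3\<close>.\<close>
    have dM2: "deriv (M i 2) t = ?c * deriv (a i) t + ?s * deriv (b i) t + \<kappa> t * M i 3 t" for i
      by (rule DERIV_imp_deriv) (auto simp: M_def algebra_simps
          intro!: derivative_eq_intros d\<theta>[OF tI] da db)
    have dM3: "deriv (M i 3) t = ?c * deriv (b i) t - ?s * deriv (a i) t - \<kappa> t * M i 2 t" for i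
      by (rule DERIV_imp_deriv) (auto simp: M_def algebra_simps
          intro!: derivative_eq_intros d\<theta>[OF tI] da db)
    note orth = orth[OF tJ]
    let ?a2 = "a 2 t" and ?a3 = "a 3 t" and ?b2 = "b 2 t" and ?b3 = "b 3 t"
    have o22: "?B t (M 2 2 t) (M 3 2 t) (M 2 2 t) (M 3 2 t) = -1"
    proof -
      have "?B t (M 2 2 t) (M 3 2 t) (M 2 2 t) (M 3 2 t) = ?c * ?c * ?B t ?a2 ?a3 ?a2 ?a3
          + 2 * ?c * ?s * ?B t ?a2 ?a3 ?b2 ?b3 + ?s * ?s * ?B t ?b2 ?b3 ?b2 ?b3"
        unfolding M bil2_def by (simp add: algebra_simps)
      then show ?thesis using cs unfolding orth by linarith
    qed
    have o33: "?B t (M 2 3 t) (M 3 3 t) (M 2 3 t) (M 3 3 t) = -1"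
    proof -
      have "?B t (M 2 3 t) (M 3 3 t) (M 2 3 t) (M 3 3 t) = ?s * ?s * ?B t ?a2 ?a3 ?a2 ?a3
          - 2 * ?c * ?s * ?B t ?a2 ?a3 ?b2 ?b3 + ?c * ?c * ?B t ?b2 ?b3 ?b2 ?b3"
        unfolding M bil2_def by (simp add: algebra_simps)
      then show ?thesis using cs unfolding orth by linarith
    qed
    have o23: "?B t (M 2 2 t) (M 3 2 t) (M 2 3 t) (M 3 3 t) = 0"
    proof -
      have "?B t (M 2 2 t) (M 3 2 t) (M 2 3 t) (M 3 3 t) = - ?c * ?s * ?B t ?a2 ?a3 ?a2 ?a3
          + (?c * ?c - ?s * ?s) * ?B t ?a2 ?a3 ?b2 ?b3 + ?c * ?s * ?B t ?b2 ?b3 ?b2 ?b3"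
        unfolding M bil2_def by (simp add: algebra_simps)
      then show ?thesis by (simp add: orth)
    qed
    have comm: "?B t x2 x3 y2 y3 = ?B t y2 y3 x2 x3" for x2 x3 y2 y3
      by (simp add: bil2_def algebra_simps)
    have gauge: "?B t (deriv (M 2 2) t) (deriv (M 3 2) t) (M 2 3 t) (M 3 3 t)
      = ?B t (M 2 2 t) (M 3 2 t) (deriv (M 2 3) t) (deriv (M 3 3) t)"
    proof -
      let ?x2 = "?c * deriv (a 2) t + ?s * deriv (b 2) t" and ?x3 = "?c * deriv (a 3) t + ?s * deriv (b 3) t"
      let ?y2 = "?c * deriv (b 2) t - ?s * deriv (a 2) t" and ?y3 = "?c * deriv (b 3) t - ?s * deriv (a 3) t"
      \<comment> \<open>By \<open>o22\<close> and \<open>o33\<close> the two terms with \<kappa> add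
        up to -2 \<kappa>; the rest is the unrotated antisymmetric part, by
        \<open>bil2_rotation\<close>.\<close>
      have "?B t (deriv (M 2 2) t) (deriv (M 3 2) t) (M 2 3 t) (M 3 3 t)
          - ?B t (M 2 2 t) (M 3 2 t) (deriv (M 2 3) t) (deriv (M 3 3) t)
        = ?B t ?x2 ?x3 (M 2 3 t) (M 3 3 t) - ?B t (M 2 2 t) (M 3 2 t) ?y2 ?y3
          + \<kappa> t * ?B t (M 2 3 t) (M 3 3 t) (M 2 3 t) (M 3 3 t)
          + \<kappa> t * ?B t (M 2 2 t) (M 3 2 t) (M 2 2 t) (M 3 2 t)"
        unfolding dM2 dM3 bil2_def by (simp add: algebra_simps)
      also have "\<dots> = ?B t ?x2 ?x3 (M 2 3 t) (M 3 3 t) - ?B t (M 2 2 t) (M 3 2 t) ?y2 ?y3 - 2 * \<kappa> t"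
        unfolding o22 o33 by simp
      also have "?B t ?x2 ?x3 (M 2 3 t) (M 3 3 t) - ?B t (M 2 2 t) (M 3 2 t) ?y2 ?y3
          = (?c * ?c + ?s * ?s) * (?B t (deriv (a 2) t) (deriv (a 3) t) ?b2 ?b3
            - ?B t ?a2 ?a3 (deriv (b 2) t) (deriv (b 3) t))"
        unfolding M by (rule bil2_rotation)
      also have "\<dots> - 2 * \<kappa> t = 0" unfolding cs \<kappa>_def by simp
      finally show ?thesis by simp
    qed
    have o32: "?B t (M 2 3 t) (M 3 3 t) (M 2 2 t) (M 3 2 t) = 0"
      using o23 by (subst comm)
    \<comment> \<open>The (3,2) equation is the (2,3) equation read backwards, by symmetry of the
      form; the diagonal equations are symmetry alone.\<close>
    have "?B t (deriv (M 2 3) t) (deriv (M 3 3) t) (M 2 2 t) (M 3 2 t)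
        = ?B t (M 2 2 t) (M 3 2 t) (deriv (M 2 3) t) (deriv (M 3 3) t)" by (rule comm)
    also have "\<dots> = ?B t (deriv (M 2 2) t) (deriv (M 3 2) t) (M 2 3 t) (M 3 3 t)"
      by (rule gauge[symmetric])
    also have "\<dots> = ?B t (M 2 3 t) (M 3 3 t) (deriv (M 2 2) t) (deriv (M 3 2) t)" by (rule comm)
    finally have gauge': "?B t (deriv (M 2 3) t) (deriv (M 3 3) t) (M 2 2 t) (M 3 2 t)
        = ?B t (M 2 3 t) (M 3 3 t) (deriv (M 2 2) t) (deriv (M 3 2) t)" .
    note gauge22 = comm[of "deriv (M 2 2) t" "deriv (M 3 2) t" "M 2 2 t" "M 3 2 t"]
      and gauge33 = comm[of "deriv (M 2 3) t" "deriv (M 3 3) t" "M 2 3 t" "M 3 3 t"]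
    have "(2::4) \<noteq> 3" "(3::4) \<noteq> 2" by simp_all
    with kl show ?thesis
      unfolding sum_B
      by (elim insertE emptyE; hypsubst)
        (simp_all only: o22 o23 o32 o33 gauge gauge' gauge22 gauge33 simp_thms if_True if_False)
  qed
  show ?thesis
    by (rule exI[of _ M]) (use M_smooth main in blast)
qed

text \<open>\<open>N2\<close>, \<open>N3\<close> stand for the u-derivative of \<open>M x\<close> at
  fixed x, \<open>V\<close> and \<open>K\<close> for the u- and x-derivatives of the quadratic form
  whose half is subtracted from v. When the form is expanded, the mixed terms cancel against
  \<open>K\<close> and the square of \<open>N\<close> against \<open>V\<close>; what
  \<open>V\<close> leaves over is \<open>H\<close>.\<close>

lemma brinkmann_identity:
  assumes orth: "bil2 p q r m22 m32 m22 m32 = -1" "bil2 p q r m22 m32 m23 m33 = 0"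
      "bil2 p q r m23 m33 m23 m33 = -1"
    and V: "V = bil2 p q r N2 N3 N2 N3 - H"
    and K: "\<And>x2 x3. K x2 x3 = 2 * bil2 p q r N2 N3 (m22 * x2 + m23 * x3) (m32 * x2 + m33 * x3)"
  shows "a1 * (b0 - 1/2 * (b1 * V + K b2 b3)) + (a0 - 1/2 * (a1 * V + K a2 a3)) * b1
    + bil2 p q r (a1 * N2 + (m22 * a2 + m23 * a3)) (a1 * N3 + (m32 * a2 + m33 * a3))
        (b1 * N2 + (m22 * b2 + m23 * b3)) (b1 * N3 + (m32 * b2 + m33 * b3))
    = a0 * b1 + a1 * b0 + H * a1 * b1 - a2 * b2 - a3 * b3"
proof -
  define A2 A3 where "A2 = m22 * a2 + m23 * a3" and "A3 = m32 * a2 + m33 * a3"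
  define B2 B3 where "B2 = m22 * b2 + m23 * b3" and "B3 = m32 * b2 + m33 * b3"
  have expand: "bil2 p q r (a1 * N2 + A2) (a1 * N3 + A3) (b1 * N2 + B2) (b1 * N3 + B3)
      = a1 * b1 * bil2 p q r N2 N3 N2 N3 + a1 * bil2 p q r N2 N3 B2 B3 + b1 * bil2 p q r N2 N3 A2 A3
        + bil2 p q r A2 A3 B2 B3"
    unfolding bil2_def by (simp add: algebra_simps)
  have "bil2 p q r A2 A3 B2 B3
      = a2 * b2 * bil2 p q r m22 m32 m22 m32 + (a2 * b3 + a3 * b2) * bil2 p q r m22 m32 m23 m33
        + a3 * b3 * bil2 p q r m23 m33 m23 m33"
    unfolding bil2_def A2_def A3_def B2_def B3_def by (simp add: algebra_simps)
  then have "bil2 p q r A2 A3 B2 B3 = - (a2 * b2 + a3 * b3)"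
    unfolding orth by simp
  with expand show ?thesis
    unfolding V K A2_def[symmetric] A3_def[symmetric] B2_def[symmetric] B3_def[symmetric]
    by (simp add: algebra_simps)
qed


section \<open>Brinkmann coordinates\<close>

text \<open>An instance of the fact that a one-sided inverse of a square matrix is two-sided; it
  turns orthonormality of the columns of \<open>M\<close> into an expansion of every vector in the
  frame.\<close>

lemma two_by_two_left_right_inverse:
  fixes a b c d :: "'a::field"
  assumes "a * a' + b * c' = 1" "a * b' + b * d' = 0" "c * a' + d * c' = 0" "c * b' + d * d' = 1"
  shows "a' * a + b' * c = 1" "a' * b + b' * d = 0" "c' * a + d' * c = 0" "c' * b + d' * d = 1"
  using assms by algebra+

lemma has_derivative_vec4:
  fixes f0 f1 f2 f3 :: "'e::real_normed_vector \<Rightarrow> real"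
  assumes "(f0 has_derivative D0) F" "(f1 has_derivative D1) F"
    "(f2 has_derivative D2) F" "(f3 has_derivative D3) F"
  shows "((\<lambda>x. vec4 (f0 x) (f1 x) (f2 x) (f3 x)) has_derivative
    (\<lambda>v. vec4 (D0 v) (D1 v) (D2 v) (D3 v))) F"
proof -
  have eq: "vec4 a b c d = a *\<^sub>R axis 0 1 + b *\<^sub>R axis 1 1 + c *\<^sub>R axis 2 1 + d *\<^sub>R axis 3 (1::real)"
    for a b c d
    by (simp add: vec4_eq_iff axis_def)
  show ?thesis
    unfolding eq by (intro has_derivative_add has_derivative_scaleR_left assms)
qed

lemma has_derivative_comp_nth:
  assumes "(f has_real_derivative D) (at (z $ i))"
  shows "((\<lambda>z :: real ^ 'n. f (z $ i)) has_derivative (\<lambda>a. D * a $ i)) (at z)"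
  using has_derivative_compose[OF bounded_linear_imp_has_derivative[OF bounded_linear_vec_nth]
      assms[unfolded has_field_derivative_def]] .

locale parallel_frame =
  fixes h M :: "4 \<Rightarrow> 4 \<Rightarrow> real \<Rightarrow> real" and \<epsilon> :: real
  assumes smooth_h: "smooth_on {-\<epsilon><..<\<epsilon>} (h i j)"
    and sym: "\<bar>t\<bar> < \<epsilon> \<Longrightarrow> h 3 2 t = h 2 3 t"
    and smooth_M: "i \<in> {2,3} \<Longrightarrow> j \<in> {2,3} \<Longrightarrow> smooth_on {-\<epsilon><..<\<epsilon>} (M i j)"
    and orth: "\<bar>t\<bar> < \<epsilon> \<Longrightarrow> k \<in> {2,3} \<Longrightarrow> l \<in> {2,3} \<Longrightarrow>
      (\<Sum>i\<in>{2,3}. \<Sum>j\<in>{2,3}. h i j t * M i k t * M j l t) = (if k = l then -1 else 0)"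
    and gauge: "\<bar>t\<bar> < \<epsilon> \<Longrightarrow> k \<in> {2,3} \<Longrightarrow> l \<in> {2,3} \<Longrightarrow>
      (\<Sum>i\<in>{2,3}. \<Sum>j\<in>{2,3}. h i j t * deriv (M i k) t * M j l t)
        = (\<Sum>i\<in>{2,3}. \<Sum>j\<in>{2,3}. h i j t * M i k t * deriv (M j l) t)"
begin

text \<open>Kept apart because this is exactly the factor that is differentiated in
  \<open>H\<close>.\<close>

definition lowered_deriv :: "4 \<Rightarrow> 4 \<Rightarrow> real \<Rightarrow> real" where
  "lowered_deriv j k = (\<lambda>t. \<Sum>i\<in>{2,3}. h i j t * deriv (M i k) t)"

text \<open>Up to the factor 1/2, the matrix of the quadratic form subtracted from v. Its symmetry
  in \<open>k\<close>, \<open>l\<close> amounts to the condition \<open>gauge\<close>, given that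
  \<open>h\<close> is symmetric.\<close>

definition frame_shear :: "4 \<Rightarrow> 4 \<Rightarrow> real \<Rightarrow> real" where
  "frame_shear k l = (\<lambda>t. \<Sum>j\<in>{2,3}. lowered_deriv j k t * M j l t)"

lemma brinkmann_map_eq:
  "brinkmann_map h M z = vec4 (z $ 1)
    (z $ 0 - 1/2 * (\<Sum>k\<in>{2,3}. \<Sum>l\<in>{2,3}. frame_shear k l (z $ 1) * z $ k * z $ l))
    (M 2 2 (z $ 1) * z $ 2 + M 2 3 (z $ 1) * z $ 3)
    (M 3 2 (z $ 1) * z $ 2 + M 3 3 (z $ 1) * z $ 3)"
  by (simp add: brinkmann_map_def frame_shear_def lowered_deriv_def Let_def algebra_simps)

lemma smooth_lowered_deriv: "k \<in> {2,3} \<Longrightarrow> smooth_on {-\<epsilon><..<\<epsilon>} (lowered_deriv j k)"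
  unfolding lowered_deriv_def
  by (intro smooth_on_sum smooth_on_mult smooth_h smooth_on_deriv smooth_M open_greaterThanLessThan)

lemma smooth_frame_shear: "k \<in> {2,3} \<Longrightarrow> l \<in> {2,3} \<Longrightarrow> smooth_on {-\<epsilon><..<\<epsilon>} (frame_shear k l)"
  unfolding frame_shear_def
  by (intro smooth_on_sum smooth_on_mult smooth_lowered_deriv smooth_M open_greaterThanLessThan)

lemma open_strip: "open {z :: real ^ 4. \<bar>z $ i\<bar> < \<epsilon>}"
  by (intro open_Collect_less continuous_intros)

lemma smooth_on_comp_nth:
  fixes f :: "real \<Rightarrow> real"
  assumes "smooth_on {-\<epsilon><..<\<epsilon>} f"
  shows "smooth_on {z :: real ^ 4. \<bar>z $ i\<bar> < \<epsilon>} (\<lambda>z. f (z $ i))"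
  by (rule smooth_on_compose[OF open_strip _ smooth_on_linear[OF open_strip linear_vec_nth] assms]) auto

text \<open>Orthonormality reads M^T h M = -1, so -M^T h inverts \<open>M\<close>: the coordinates
  x^k arise by contraction with \<open>h\<close>, without dividing by a determinant, and are visibly
  smooth.\<close>

definition brinkmann_coord :: "4 \<Rightarrow> real ^ 4 \<Rightarrow> real" where
  "brinkmann_coord k y = - (\<Sum>i\<in>{2,3}. \<Sum>j\<in>{2,3}. h i j (y $ 0) * M i k (y $ 0) * y $ j)"

definition brinkmann_inverse :: "real ^ 4 \<Rightarrow> real ^ 4" where
  "brinkmann_inverse y = vec4
    (y $ 1 + 1/2 * (\<Sum>k\<in>{2,3}. \<Sum>l\<in>{2,3}. frame_shear k l (y $ 0) * brinkmann_coord k y * brinkmann_coord l y))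
    (y $ 0) (brinkmann_coord 2 y) (brinkmann_coord 3 y)"

lemma smooth_on_brinkmann_map: "smooth_on {z. \<bar>z $ 1\<bar> < \<epsilon>} (brinkmann_map h M)"
  unfolding brinkmann_map_eq[abs_def] sum_23
  by (intro smooth_on_vec4 smooth_on_diff smooth_on_add smooth_on_mult smooth_on_const open_strip
      smooth_on_comp_nth smooth_frame_shear smooth_M smooth_on_linear linear_vec_nth) auto

lemma smooth_on_brinkmann_inverse: "smooth_on {y. \<bar>y $ 0\<bar> < \<epsilon>} brinkmann_inverse"
proof -
  note nth = smooth_on_linear[OF open_strip linear_vec_nth]
  have coord: "smooth_on {y. \<bar>y $ 0\<bar> < \<epsilon>} (\<lambda>y. brinkmann_coord k y)" if k: "k \<in> {2,3}" for k
  proof -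
    have "smooth_on {y. \<bar>y $ 0\<bar> < \<epsilon>} (\<lambda>y. h i j (y $ 0) * M i k (y $ 0) * y $ j)"
      if "i \<in> {2,3}" for i j
      using smooth_on_mult[OF open_strip smooth_on_mult[OF open_strip
            smooth_on_comp_nth[OF smooth_h] smooth_on_comp_nth[OF smooth_M[OF that k]]] nth] .
    then show ?thesis
      unfolding brinkmann_coord_def by (intro smooth_on_minus smooth_on_sum open_strip)
  qed
  have "smooth_on {y. \<bar>y $ 0\<bar> < \<epsilon>} (\<lambda>y. frame_shear k l (y $ 0) * brinkmann_coord k y * brinkmann_coord l y)"
    if "k \<in> {2,3}" "l \<in> {2,3}" for k l
    using smooth_on_mult[OF open_strip smooth_on_mult[OF open_strip
          smooth_on_comp_nth[OF smooth_frame_shear[OF that]] coord[OF that(1)]] coord[OF that(2)]] .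
  then have "smooth_on {y. \<bar>y $ 0\<bar> < \<epsilon>} (\<lambda>y. \<Sum>k\<in>{2,3}. \<Sum>l\<in>{2,3}.
      frame_shear k l (y $ 0) * brinkmann_coord k y * brinkmann_coord l y)"
    by (intro smooth_on_sum open_strip)
  note v = smooth_on_add[OF open_strip nth smooth_on_mult[OF open_strip smooth_on_const this]]
  show ?thesis
    unfolding brinkmann_inverse_def[abs_def]
    by (intro smooth_on_vec4[OF open_strip] v nth coord insertI1 insertI2)
qed

lemma brinkmann_coord_frame:
  assumes "\<bar>y $ 0\<bar> < \<epsilon>" "k \<in> {2,3}"
    "y $ 2 = M 2 2 (y $ 0) * x 2 + M 2 3 (y $ 0) * x 3" "y $ 3 = M 3 2 (y $ 0) * x 2 + M 3 3 (y $ 0) * x 3"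
  shows "brinkmann_coord k y = x k"
proof -
  have "brinkmann_coord k y = - (\<Sum>l\<in>{2,3}. (\<Sum>i\<in>{2,3}. \<Sum>j\<in>{2,3}.
      h i j (y $ 0) * M i k (y $ 0) * M j l (y $ 0)) * x l)"
    unfolding brinkmann_coord_def sum_23 assms(3,4) by (simp add: algebra_simps)
  also have "\<dots> = - (\<Sum>l\<in>{2,3}. (if k = l then -1 else 0) * x l)"
    using orth[OF assms(1,2)] by simp
  also have "\<dots> = x k" using assms(2) by auto
  finally show ?thesis .
qed

text \<open>Orthonormality directly yields a left inverse of the frame matrix, as used in
  \<open>brinkmann_coord_frame\<close>; here the product in the other order is needed.\<close>

lemma frame_brinkmann_coord:
  assumes "\<bar>y $ 0\<bar> < \<epsilon>"
  shows "M 2 2 (y $ 0) * brinkmann_coord 2 y + M 2 3 (y $ 0) * brinkmann_coord 3 y = y $ 2"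
    "M 3 2 (y $ 0) * brinkmann_coord 2 y + M 3 3 (y $ 0) * brinkmann_coord 3 y = y $ 3"
proof -
  let ?u = "y $ 0"
  define c where "c = (\<lambda>k j. - (h 2 j ?u * M 2 k ?u + h 3 j ?u * M 3 k ?u))"
  have coord: "brinkmann_coord k y = c k 2 * y $ 2 + c k 3 * y $ 3" for k
    by (simp add: brinkmann_coord_def c_def algebra_simps)
  have "c k 2 * M 2 l ?u + c k 3 * M 3 l ?u = (if k = l then 1 else 0)"
    if "k \<in> {2,3}" "l \<in> {2,3}" for k l
    using orth[OF assms that] by (auto simp: c_def algebra_simps split: if_splits)
  from this[of 2 2] this[of 2 3] this[of 3 2] this[of 3 3]
  have "c 2 2 * M 2 2 ?u + c 2 3 * M 3 2 ?u = 1" "c 2 2 * M 2 3 ?u + c 2 3 * M 3 3 ?u = 0"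
    "c 3 2 * M 2 2 ?u + c 3 3 * M 3 2 ?u = 0" "c 3 2 * M 2 3 ?u + c 3 3 * M 3 3 ?u = 1"
    by simp_all
  note inv = two_by_two_left_right_inverse[OF this]
  have "M 2 2 ?u * brinkmann_coord 2 y + M 2 3 ?u * brinkmann_coord 3 y
      = (M 2 2 ?u * c 2 2 + M 2 3 ?u * c 3 2) * y $ 2 + (M 2 2 ?u * c 2 3 + M 2 3 ?u * c 3 3) * y $ 3"
    unfolding coord by (simp add: algebra_simps)
  then show "M 2 2 ?u * brinkmann_coord 2 y + M 2 3 ?u * brinkmann_coord 3 y = y $ 2"
    unfolding inv by simp
  have "M 3 2 ?u * brinkmann_coord 2 y + M 3 3 ?u * brinkmann_coord 3 y
      = (M 3 2 ?u * c 2 2 + M 3 3 ?u * c 3 2) * y $ 2 + (M 3 2 ?u * c 2 3 + M 3 3 ?u * c 3 3) * y $ 3"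
    unfolding coord by (simp add: algebra_simps)
  then show "M 3 2 ?u * brinkmann_coord 2 y + M 3 3 ?u * brinkmann_coord 3 y = y $ 3"
    unfolding inv by simp
qed

lemma diffeomorphism_brinkmann_map:
  "diffeomorphism_between {z. \<bar>z $ 1\<bar> < \<epsilon>} {y. \<bar>y $ 0\<bar> < \<epsilon>} (brinkmann_map h M)"
proof (rule diffeomorphism_betweenI(1)[OF open_strip open_strip smooth_on_brinkmann_map
      smooth_on_brinkmann_inverse])
  fix z :: "real ^ 4" assume z: "z \<in> {z. \<bar>z $ 1\<bar> < \<epsilon>}"
  then show "brinkmann_map h M z \<in> {y. \<bar>y $ 0\<bar> < \<epsilon>}"
    by (simp add: brinkmann_map_eq)
  have "brinkmann_coord k (brinkmann_map h M z) = z $ k" if "k \<in> {2,3}" for k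
    by (rule brinkmann_coord_frame[OF _ that]) (use z in \<open>simp_all add: brinkmann_map_eq\<close>)
  then have "brinkmann_coord 2 (brinkmann_map h M z) = z $ 2"
    "brinkmann_coord 3 (brinkmann_map h M z) = z $ 3" by simp_all
  then show "brinkmann_inverse (brinkmann_map h M z) = z"
    unfolding brinkmann_inverse_def sum_23 by (simp add: vec4_eq_iff brinkmann_map_eq)
next
  fix y :: "real ^ 4" assume y: "y \<in> {y. \<bar>y $ 0\<bar> < \<epsilon>}"
  then show "brinkmann_inverse y \<in> {z. \<bar>z $ 1\<bar> < \<epsilon>}"
    by (simp add: brinkmann_inverse_def)
  show "brinkmann_map h M (brinkmann_inverse y) = y"
    using frame_brinkmann_coord[of y] y
    unfolding brinkmann_map_eq brinkmann_inverse_def sum_23 by (simp add: vec4_eq_iff)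
qed

lemma form_of_brinkmann_metric:
  "form_of (brinkmann_metric h M) z a b = a $ 0 * b $ 1 + a $ 1 * b $ 0
    + (- (\<Sum>j\<in>{2,3}. \<Sum>k\<in>{2,3}. \<Sum>l\<in>{2,3}.
        deriv (lowered_deriv j k) (z $ 1) * M j l (z $ 1) * z $ k * z $ l)) * a $ 1 * b $ 1
    - a $ 2 * b $ 2 - a $ 3 * b $ 3"
  unfolding form_of_eq sum_UNIV_4_from_0 brinkmann_metric_def Let_def lowered_deriv_def
  by (simp add: algebra_simps del: sum.insert)

lemma pullback_brinkmann_map:
  assumes z: "\<bar>z $ 1\<bar> < \<epsilon>"
    and g: "\<And>a b. g (brinkmann_map h M z) a b = a $ 0 * b $ 1 + a $ 1 * b $ 0
      + bil2 (h 2 2 (z $ 1)) (h 2 3 (z $ 1)) (h 3 3 (z $ 1)) (a $ 2) (a $ 3) (b $ 2) (b $ 3)"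
  shows "pullback (brinkmann_map h M) g z a b = form_of (brinkmann_metric h M) z a b"
proof -
  let ?u = "z $ 1"
  have u: "?u \<in> {-\<epsilon><..<\<epsilon>}" using z by auto
  define m where "m = (\<lambda>i k. M i k ?u)"
  define n where "n = (\<lambda>i k. deriv (M i k) ?u)"
  define w where "w = (\<lambda>k l. frame_shear k l ?u)"
  define t where "t = (\<lambda>j k. lowered_deriv j k ?u)"
  define t' where "t' = (\<lambda>j k. deriv (lowered_deriv j k) ?u)"
  define w' where "w' = (\<lambda>k l. t' 2 k * m 2 l + t 2 k * n 2 l + (t' 3 k * m 3 l + t 3 k * n 3 l))"
  let ?B = "bil2 (h 2 2 ?u) (h 2 3 ?u) (h 3 3 ?u)"
  have dM: "(M i k has_real_derivative n i k) (at ?u)" if "i \<in> {2,3}" "k \<in> {2,3}" for i k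
    unfolding n_def by (rule smooth_on_DERIV[OF smooth_M[OF that] u])
  have dT: "(lowered_deriv j k has_real_derivative t' j k) (at ?u)" if "k \<in> {2,3}" for j k
    unfolding t'_def by (rule smooth_on_DERIV[OF smooth_lowered_deriv[OF that] u])
  have dW: "(frame_shear k l has_real_derivative w' k l) (at ?u)" if "k \<in> {2,3}" "l \<in> {2,3}" for k l
  proof -
    have "((\<lambda>s. lowered_deriv 2 k s * M 2 l s + lowered_deriv 3 k s * M 3 l s) has_real_derivative w' k l) (at ?u)"
      unfolding w'_def m_def t_def
      by (auto intro!: derivative_eq_intros dT dM that simp: algebra_simps)
    then show ?thesis unfolding frame_shear_def by simp
  qed
  note [derivative_intros] = has_derivative_comp_nth[OF dM] has_derivative_comp_nth[OF dW]
    bounded_linear_imp_has_derivative[OF bounded_linear_vec_nth]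
  define V where "V = (\<Sum>k\<in>{2,3}. \<Sum>l\<in>{2,3}. w' k l * z $ k * z $ l)"
  define K where "K = (\<lambda>x2 x3. w 2 2 * (2 * z $ 2 * x2) + (w 2 3 + w 3 2) * (z $ 2 * x3 + x2 * z $ 3)
    + w 3 3 * (2 * z $ 3 * x3))"
  define N2 where "N2 = n 2 2 * z $ 2 + n 2 3 * z $ 3"
  define N3 where "N3 = n 3 2 * z $ 2 + n 3 3 * z $ 3"
  define D where "D = (\<lambda>a :: real ^ 4. vec4 (a $ 1) (a $ 0 - 1/2 * (a $ 1 * V + K (a $ 2) (a $ 3)))
    (a $ 1 * N2 + (m 2 2 * a $ 2 + m 2 3 * a $ 3)) (a $ 1 * N3 + (m 3 2 * a $ 2 + m 3 3 * a $ 3)))"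
  have "(brinkmann_map h M has_derivative D) (at z)"
    unfolding brinkmann_map_eq[abs_def] D_def sum_23
    by (intro has_derivative_vec4)
      (auto intro!: derivative_eq_intros simp: V_def K_def N2_def N3_def m_def w_def algebra_simps add_divide_distrib fun_eq_iff)
  then have D: "frechet_derivative (brinkmann_map h M) (at z) = D"
    by (rule frechet_derivative_at[symmetric])
  have sum_B: "(\<Sum>i\<in>{2,3}. \<Sum>j\<in>{2,3}. h i j ?u * x i * y j) = ?B (x 2) (x 3) (y 2) (y 3)"
    for x y :: "4 \<Rightarrow> real"
    by (simp add: bil2_def sym[OF z] algebra_simps)
  have orth': "?B (m 2 k) (m 3 k) (m 2 l) (m 3 l) = (if k = l then -1 else 0)"
    if "k \<in> {2,3}" "l \<in> {2,3}" for k l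
    using orth[OF z that] by (simp only: sum_B m_def)
  have w_B: "w k l = ?B (n 2 k) (n 3 k) (m 2 l) (m 3 l)" for k l
    by (simp add: w_def frame_shear_def lowered_deriv_def n_def m_def bil2_def sym[OF z] algebra_simps)
  have "w 2 3 = ?B (m 2 2) (m 3 2) (n 2 3) (n 3 3)"
    using gauge[OF z, of 2 3] by (simp only: sum_B w_B n_def m_def insertI1 insertI2)
  \<comment> \<open>The derivative of a quadratic form sees only the symmetric part of its matrix.
    Symmetry of \<open>w\<close> makes \<open>K\<close> twice the contraction with the full matrix,
    as required to cancel the mixed terms.\<close>
  then have w_sym: "w 2 3 = w 3 2"
    by (simp add: w_B bil2_def algebra_simps)
  define H where "H = - (\<Sum>j\<in>{2,3}. \<Sum>k\<in>{2,3}. \<Sum>l\<in>{2,3}. t' j k * m j l * z $ k * z $ l)"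
  \<comment> \<open>The product rule splits the derivative of \<open>frame_shear\<close>:
    differentiating the lowered factor gives \<open>- H\<close>, differentiating \<open>M\<close>
    gives the square of \<open>N\<close>.\<close>
  have V: "V = ?B N2 N3 N2 N3 - H"
    unfolding V_def H_def w'_def N2_def N3_def bil2_def
    by (simp add: t_def lowered_deriv_def n_def sym[OF z] algebra_simps)
  have K: "K x2 x3 = 2 * ?B N2 N3 (m 2 2 * x2 + m 2 3 * x3) (m 3 2 * x2 + m 3 3 * x3)" for x2 x3
  proof -
    have "K x2 x3 = 2 * (w 2 2 * z $ 2 * x2 + w 2 3 * z $ 2 * x3 + w 3 2 * z $ 3 * x2 + w 3 3 * z $ 3 * x3)"
      by (simp add: K_def w_sym algebra_simps)
    also have "\<dots> = 2 * ?B N2 N3 (m 2 2 * x2 + m 2 3 * x3) (m 3 2 * x2 + m 3 3 * x3)"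
      unfolding w_B N2_def N3_def bil2_def by (simp add: algebra_simps)
    finally show ?thesis .
  qed
  have "pullback (brinkmann_map h M) g z a b
      = a $ 1 * (b $ 0 - 1/2 * (b $ 1 * V + K (b $ 2) (b $ 3)))
        + (a $ 0 - 1/2 * (a $ 1 * V + K (a $ 2) (a $ 3))) * b $ 1
        + ?B (a $ 1 * N2 + (m 2 2 * a $ 2 + m 2 3 * a $ 3)) (a $ 1 * N3 + (m 3 2 * a $ 2 + m 3 3 * a $ 3))
            (b $ 1 * N2 + (m 2 2 * b $ 2 + m 2 3 * b $ 3)) (b $ 1 * N3 + (m 3 2 * b $ 2 + m 3 3 * b $ 3))"
    unfolding pullback_def D g by (simp add: D_def)
  also have "\<dots> = a $ 0 * b $ 1 + a $ 1 * b $ 0 + H * a $ 1 * b $ 1 - a $ 2 * b $ 2 - a $ 3 * b $ 3"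
    by (rule brinkmann_identity[OF _ _ _ V K]) (simp_all add: orth')
  also have "\<dots> = form_of (brinkmann_metric h M) z a b"
    unfolding form_of_brinkmann_metric H_def t'_def m_def ..
  finally show ?thesis .
qed

end

section \<open>Part (iii) for lightlike components\<close>

lemma (in lightlike_components) brinkmann_form:
  assumes "0 \<in> C"
  defines "h \<equiv> \<lambda>i j t. G (vec4 t 0 0 0) $ i $ j"
  shows "\<exists>\<epsilon>>0. (\<forall>t. \<bar>t\<bar> < \<epsilon> \<longrightarrow> vec4 t 0 0 0 \<in> C) \<and>
      (\<exists>M :: 4 \<Rightarrow> 4 \<Rightarrow> real \<Rightarrow> real.
        (\<forall>i\<in>{2,3}. \<forall>j\<in>{2,3}. smooth_on {-\<epsilon><..<\<epsilon>} (M i j)) \<and>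
        (\<forall>t. \<bar>t\<bar> < \<epsilon> \<longrightarrow> (\<forall>k\<in>{2,3}. \<forall>l\<in>{2,3}.
           (\<Sum>i\<in>{2,3}. \<Sum>j\<in>{2,3}. h i j t * M i k t * M j l t) = (if k = l then -1 else 0) \<and>
           (\<Sum>i\<in>{2,3}. \<Sum>j\<in>{2,3}. h i j t * deriv (M i k) t * M j l t)
             = (\<Sum>i\<in>{2,3}. \<Sum>j\<in>{2,3}. h i j t * M i k t * deriv (M j l) t))) \<and>
        diffeomorphism_between {z. \<bar>z $ 1\<bar> < \<epsilon>} {y. \<bar>y $ 0\<bar> < \<epsilon>} (brinkmann_map h M) \<and>
        (\<forall>z. \<bar>z $ 1\<bar> < \<epsilon> \<longrightarrow> (\<forall>a b.
           pullback (brinkmann_map h M) (form_of (limit_metric G)) z a b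
             = form_of (brinkmann_metric h M) z a b)))"
proof -
  let ?ray = "\<lambda>t :: real. vec4 t 0 0 (0::real)"
  have ray: "linear ?ray" by (intro linearI) (simp_all add: vec4_eq_iff)
  have "open (?ray -` C)"
    using linear_conv_bounded_linear ray
    by (intro open_vimage open_C linear_continuous_on) blast
  moreover have "?ray 0 = 0" by (simp add: vec4_eq_iff)
  then have "0 \<in> ?ray -` C" using assms(1) by simp
  ultimately obtain \<delta> where \<delta>: "\<delta> > 0" "ball 0 \<delta> \<subseteq> ?ray -` C"
    using open_contains_ball by blast
  then have in_C: "?ray t \<in> C" if "\<bar>t\<bar> < \<delta>" for t
    using that by (auto simp: subset_iff dist_real_def)
  let ?J = "{-\<delta><..<\<delta>}"
  \<comment> \<open>Strictly inside \<delta>, to leave room for the integration that produces the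
    rotation angle.\<close>
  define \<epsilon> where "\<epsilon> = \<delta> / 2"
  have \<epsilon>: "\<epsilon> > 0" "\<epsilon> < \<delta>" using \<delta>(1) by (auto simp: \<epsilon>_def)
  have h_smooth: "smooth_on ?J (h i j)" for i j
    unfolding h_def
    by (rule smooth_on_entry[OF open_greaterThanLessThan smooth_on_linear[OF open_greaterThanLessThan ray]])
      (auto intro!: in_C)
  have J: "?ray t \<in> C" if "t \<in> ?J" for t using that by (intro in_C) auto
  have "h 3 2 t = h 2 3 t" "h 2 2 t < 0" "h 2 2 t * h 3 3 t - (h 2 3 t)\<^sup>2 > 0" if "t \<in> ?J" for t
    unfolding h_def by (fact G_symmetric[OF J[OF that]] transverse_negative[OF J[OF that]])+
  note h = this
  obtain M :: "4 \<Rightarrow> 4 \<Rightarrow> real \<Rightarrow> real" where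
    M: "\<forall>i\<in>{2,3}. \<forall>j\<in>{2,3}. smooth_on {-\<epsilon><..<\<epsilon>} (M i j)"
    and frame: "\<forall>t. \<bar>t\<bar> < \<epsilon> \<longrightarrow> (\<forall>k\<in>{2,3}. \<forall>l\<in>{2,3}.
      (\<Sum>i\<in>{2,3}. \<Sum>j\<in>{2,3}. h i j t * M i k t * M j l t) = (if k = l then -1 else 0) \<and>
      (\<Sum>i\<in>{2,3}. \<Sum>j\<in>{2,3}. h i j t * deriv (M i k) t * M j l t)
        = (\<Sum>i\<in>{2,3}. \<Sum>j\<in>{2,3}. h i j t * M i k t * deriv (M j l) t))"
    by (rule exE[OF parallel_frame_exists[OF \<epsilon>(2) h_smooth h]], assumption+, elim conjE, rule that)
  interpret parallel_frame h M \<epsilon>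
  proof
    show "smooth_on {-\<epsilon><..<\<epsilon>} (h i j)" for i j
      by (rule smooth_on_subset[OF h_smooth]) (use \<epsilon> in auto)
    show "h 3 2 t = h 2 3 t" if "\<bar>t\<bar> < \<epsilon>" for t
      by (rule h(1)) (use that \<epsilon> in auto)
    show "smooth_on {-\<epsilon><..<\<epsilon>} (M i j)" if "i \<in> {2,3}" "j \<in> {2,3}" for i j
      using M that by blast
    fix t k l assume "\<bar>t\<bar> < \<epsilon>" "k \<in> {2,3::4}" "l \<in> {2,3::4}"
    note * = frame[rule_format, OF this]
    show "(\<Sum>i\<in>{2,3}. \<Sum>j\<in>{2,3}. h i j t * M i k t * M j l t) = (if k = l then -1 else 0)"
      by (rule conjunct1[OF *])
    show "(\<Sum>i\<in>{2,3}. \<Sum>j\<in>{2,3}. h i j t * deriv (M i k) t * M j l t)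
      = (\<Sum>i\<in>{2,3}. \<Sum>j\<in>{2,3}. h i j t * M i k t * deriv (M j l) t)"
      by (rule conjunct2[OF *])
  qed
  have "pullback (brinkmann_map h M) (form_of (limit_metric G)) z a b
      = form_of (brinkmann_metric h M) z a b" if z: "\<bar>z $ 1\<bar> < \<epsilon>" for z a b
  proof (rule pullback_brinkmann_map[OF z])
    have "brinkmann_map h M z $ 0 = z $ 1" by (simp add: brinkmann_map_eq)
    moreover have "?ray (z $ 1) \<in> C" using z \<epsilon> by (intro in_C) simp
    ultimately show "form_of (limit_metric G) (brinkmann_map h M z) a b = a $ 0 * b $ 1 + a $ 1 * b $ 0
        + bil2 (h 2 2 (z $ 1)) (h 2 3 (z $ 1)) (h 3 3 (z $ 1)) (a $ 2) (a $ 3) (b $ 2) (b $ 3)" for a b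
      using form_of_limit_metric[of "brinkmann_map h M z"] by (simp add: bil2_def h_def)
  qed
  then have "\<forall>z. \<bar>z $ 1\<bar> < \<epsilon> \<longrightarrow> (\<forall>a b.
      pullback (brinkmann_map h M) (form_of (limit_metric G)) z a b
        = form_of (brinkmann_metric h M) z a b)"
    by (intro allI impI)
  moreover have "\<forall>t. \<bar>t\<bar> < \<epsilon> \<longrightarrow> ?ray t \<in> C"
    using \<epsilon>(2) in_C by (intro allI impI) simp
  ultimately show ?thesis
    by (intro exI[of _ \<epsilon>] exI[of _ M] conjI \<epsilon>(1) M frame diffeomorphism_brinkmann_map)
qed

text \<open>The field enters through its values in the conic closure, where \<open>L\<close> has
  smooth extensions and the fundamental tensor is Lorentzian. Lightlike coordinates make its
  components constant, as \<open>smooth_on_metric_at_field\<close> demands.\<close>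

lemma lightlike_components_metric_at_field:
  fixes \<A> :: "('a, real ^ 4) chart set"
  assumes spacetime: "finsler_spacetime X \<A> A L" and field: "lightlike_gradient_field X \<A> A L D N"
    and coords: "lightlike_coordinates X \<A> A L N c" and "fst c \<subseteq> D"
  shows "lightlike_components (snd c ` fst c) (metric_components (metric_at_field X \<A> A L N c))"
    and "x \<in> snd c ` fst c \<Longrightarrow>
      form_of (metric_components (metric_at_field X \<A> A L N c)) x = metric_at_field X \<A> A L N c x"
proof -
  let ?g = "metric_at_field X \<A> A L N c" and ?C = "snd c ` fst c"
  interpret manifold X \<A>
    using spacetime by unfold_locales (simp only: finsler_spacetime_def)
  have c: "c \<in> \<A>" and N: "\<And>p. p \<in> fst c \<Longrightarrow> N p = coord_vec \<A> c p (axis 0 1)"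
    using coords unfolding lightlike_coordinates_def by blast+
  obtain f where "is_gradient X \<A> A L D f N"
    using field unfolding lightlike_gradient_field_def by blast
  then have closure: "(p, N p) \<in> conic_closure X \<A> A" if "p \<in> fst c" for p
    using that assms(4) unfolding is_gradient_def by blast
  have A: "openin (slit_topology X \<A>) A"
    and L: "smooth_fun (bundle_topology X \<A>) (bundle_atlas X \<A>) (conic_closure X \<A> A) L"
    and form: "\<And>p v. (p, v) \<in> conic_closure X \<A> A \<Longrightarrow> p \<in> fst c \<Longrightarrow>
      lorentzian_form (\<lambda>a b. fundamental_tensor X \<A> A L p v (coord_vec \<A> c p a) (coord_vec \<A> c p b))"
    using spacetime c unfolding finsler_spacetime_def by blast+
  have lorentzian: "lorentzian_form (?g x)" if "x \<in> ?C" for x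
    using form[OF closure[OF chart_inv_in[OF that]] chart_inv_in[OF that]]
    by (simp add: metric_at_field_def[abs_def] Let_def)
  \<comment> \<open>\<open>lorentzian_form\<close> includes bilinearity, and a bilinear form is
    recovered from its components.\<close>
  show form_eq: "form_of (metric_components ?g) x = ?g x" if "x \<in> ?C" for x
    by (rule form_of_metric_components) (use lorentzian[OF that] in \<open>simp add: lorentzian_form_def\<close>)
  show "lightlike_components ?C (metric_components ?g)"
  proof
    show C: "open ?C" by (rule open_chart_image[OF c])
    have "smooth_on ?C (\<lambda>x. metric_components ?g x $ i $ j)" for i j
      unfolding metric_components_def
      using smooth_on_metric_at_field[OF c A L closure N] by simp
    then show "smooth_on ?C (metric_components ?g)"
      by (intro smooth_on_vecI C)
    fix x assume x: "x \<in> ?C"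
    show "lorentzian_form (form_of (metric_components ?g) x)"
      using lorentzian[OF x] form_eq[OF x] by simp
    let ?G = "metric_components ?g x"
    have *: "?G = vec4 (vec4 0 1 0 0) (vec4 1 (?G $ 1 $ 1) (?G $ 1 $ 2) (?G $ 1 $ 3))
        (vec4 0 (?G $ 2 $ 1) (?G $ 2 $ 2) (?G $ 2 $ 3)) (vec4 0 (?G $ 3 $ 1) (?G $ 3 $ 2) (?G $ 3 $ 3)) \<and>
      (\<forall>\<xi>. \<xi> 2 \<noteq> 0 \<or> \<xi> 3 \<noteq> 0 \<longrightarrow> (\<Sum>i\<in>{2,3}. \<Sum>j\<in>{2,3}. ?G $ i $ j * \<xi> i * \<xi> j) < 0)"
      using coords x unfolding lightlike_coordinates_def Let_def by blast
    then show "?G = vec4 (vec4 0 1 0 0) (vec4 1 (?G $ 1 $ 1) (?G $ 1 $ 2) (?G $ 1 $ 3))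
        (vec4 0 (?G $ 2 $ 1) (?G $ 2 $ 2) (?G $ 2 $ 3)) (vec4 0 (?G $ 3 $ 1) (?G $ 3 $ 2) (?G $ 3 $ 3))"
      by (rule conjunct1)
    show "(\<Sum>i\<in>{2,3}. \<Sum>j\<in>{2,3}. ?G $ i $ j * \<xi> i * \<xi> j) < 0" if "\<xi> 2 \<noteq> 0 \<or> \<xi> 3 \<noteq> 0" for \<xi>
      using conjunct2[OF *] that by (intro mp[OF spec[OF conjunct2[OF *], of \<xi>]])
  qed
qed

theorem mainTheorem8:
  fixes X :: "'a topology" and \<A> :: "('a, real ^ 4) chart set"
    and A :: "('a \<times> ('a, real ^ 4) tvec) set"
    and L :: "'a \<times> ('a, real ^ 4) tvec \<Rightarrow> real"
    and D :: "'a set" and N :: "'a \<Rightarrow> ('a, real ^ 4) tvec"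
    and c :: "('a, real ^ 4) chart"
  defines "gN \<equiv> metric_at_field X \<A> A L N c"
    and "C \<equiv> snd c ` fst c"
    and "h \<equiv> \<lambda>i j t. metric_components (metric_at_field X \<A> A L N c) (vec4 t 0 0 0) $ i $ j"
  assumes "finsler_spacetime X \<A> A L"
    and "lightlike_gradient_field X \<A> A L D N"
    and "lightlike_coordinates X \<A> A L N c"
    and "fst c \<subseteq> D" and "0 \<in> C"
  shows
    "(\<forall>\<Omega>>0.
        diffeomorphism_between C (scaling \<Omega> ` C) (scaling \<Omega>) \<and>
        lorentzian_metric_on (scaling \<Omega> ` C) (rescaled_metric (metric_components gN) \<Omega>) \<and>
        (\<forall>y\<in>scaling \<Omega> ` C. \<forall>a b. pullback (inv_into C (scaling \<Omega>)) gN y a b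
           = \<Omega>\<^sup>2 * form_of (rescaled_metric (metric_components gN) \<Omega>) y a b))
   \<and> (lorentzian_metric_on {y. vec4 (y $ 0) 0 0 0 \<in> C} (limit_metric (metric_components gN)) \<and>
      (\<forall>y. vec4 (y $ 0) 0 0 0 \<in> C \<longrightarrow>
        (\<forall>\<^sub>F \<Omega> in at_right 0. y \<in> scaling \<Omega> ` C) \<and>
        (\<forall>i j. ((\<lambda>\<Omega>. rescaled_metric (metric_components gN) \<Omega> y $ i $ j)
                  \<longlongrightarrow> limit_metric (metric_components gN) y $ i $ j) (at_right 0))))
   \<and> (\<exists>\<epsilon>>0. (\<forall>t. \<bar>t\<bar> < \<epsilon> \<longrightarrow> vec4 t 0 0 0 \<in> C) \<and>
      (\<exists>M :: 4 \<Rightarrow> 4 \<Rightarrow> real \<Rightarrow> real.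
        (\<forall>i\<in>{2,3}. \<forall>j\<in>{2,3}. smooth_on {-\<epsilon><..<\<epsilon>} (M i j)) \<and>
        (\<forall>t. \<bar>t\<bar> < \<epsilon> \<longrightarrow> (\<forall>k\<in>{2,3}. \<forall>l\<in>{2,3}.
           (\<Sum>i\<in>{2,3}. \<Sum>j\<in>{2,3}. h i j t * M i k t * M j l t) = (if k = l then -1 else 0) \<and>
           (\<Sum>i\<in>{2,3}. \<Sum>j\<in>{2,3}. h i j t * deriv (M i k) t * M j l t)
             = (\<Sum>i\<in>{2,3}. \<Sum>j\<in>{2,3}. h i j t * M i k t * deriv (M j l) t))) \<and>
        diffeomorphism_between {z. \<bar>z $ 1\<bar> < \<epsilon>} {y. \<bar>y $ 0\<bar> < \<epsilon>} (brinkmann_map h M) \<and>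
        (\<forall>z. \<bar>z $ 1\<bar> < \<epsilon> \<longrightarrow> (\<forall>a b.
           pullback (brinkmann_map h M) (form_of (limit_metric (metric_components gN))) z a b
             = form_of (brinkmann_metric h M) z a b))))"
proof -
  let ?G = "metric_components gN"
  note spacetime = assms(4-7)
  interpret lightlike_components C ?G
    unfolding gN_def C_def by (rule lightlike_components_metric_at_field(1)[OF spacetime])
  have form_eq: "form_of ?G x = gN x" if "x \<in> C" for x
    using lightlike_components_metric_at_field(2)[OF spacetime] that unfolding gN_def C_def by blast
  have pullback: "pullback (inv_into C (scaling \<Omega>)) gN y a b
      = \<Omega>\<^sup>2 * form_of (rescaled_metric ?G \<Omega>) y a b" if "\<Omega> > 0" "y \<in> scaling \<Omega> ` C" for \<Omega> y a b
  proof -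
    \<comment> \<open>\<open>gN\<close> and the form built from its components are known to agree
      only over \<open>C\<close>, so the base point must be seen to lie there before one is
      exchanged for the other.\<close>
    have "inv_into C (scaling \<Omega>) y \<in> C" using that(2) by (rule inv_into_into)
    then have "pullback (inv_into C (scaling \<Omega>)) gN y a b
        = pullback (inv_into C (scaling \<Omega>)) (form_of ?G) y a b"
      by (simp only: pullback_def form_eq)
    also have "\<dots> = \<Omega>\<^sup>2 * form_of (rescaled_metric ?G \<Omega>) y a b"
      by (rule pullback_inv_scaling) (use that in auto)
    finally show ?thesis .
  qed
  have h: "h = (\<lambda>i j t. ?G (vec4 t 0 0 0) $ i $ j)" by (simp only: h_def gN_def)
  show ?thesis
    unfolding h
    by (intro conjI allI impI ballI diffeomorphism_scaling lorentzian_metric_on_rescaled pullback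
        lorentzian_metric_on_limit eventually_in_scaling_image rescaled_metric_tendsto
        brinkmann_form[OF assms(8)]) simp_all
qed

end
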